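(* Let $N\ge 3$ and let $T^1_N$ be the cycle with vertex set $X=\{x_0,\dots,x_{N-1}\}$ (indices mod $N$) and edges $\{x_j,x_{j+1}\}$. Let $M\subset X$ be a nonempty set of marked vertices, $m=|M|$, and let $W'$ be the search time evolution matrix on $T^1_N$ with marked set $M$ (defined in the context). Let $F'\subset X\setminus M$ be the set of non-marked vertices both of whose neighbours are marked, and let $F_1,\dots,F_r$ be the remaining connected components of the subgraph of $T^1_N$ induced on $X\setminus M$ (each a path with at least two vertices), $F=F_1\sqcup\dots\sqcup F_r$, so $X\setminus M=F\sqcup F'$. Put $c_M=|M|/N$, $c_F=|F|/N$, $c_{F'}=|F'|/N$, $c_j=|F_j|/N$. Then for real $u\in(0,1)$, $$\zeta(W',T^1_N,u)^{-1}=\exp\Big[3c_M\log(1-u)+2c_{F'}\log(1+u)+\frac1N\sum_{j=1}^r\sum_{k=1}^{c_jN}\log\Big\{1-2\cos\Big(\frac{2k\pi}{c_jN+1}\Big)u+u^2\Big\}\Big].$$ Moreover, if $N\to\infty$ along a sequence of configurations for which $r$ and the ratios $c_M,c_{F'},c_1,\dots,c_r$ (hence $c_F=c_1+\dots+c_r$) do not depend on $N$, then $$\lim_{N\to\infty}\zeta(W',T^1_N,u)^{-1}=\exp\Big[3c_M\log(1-u)+2c_{F'}\log(1+u)+c_F\int_0^{2\pi}\log(1-2\cos\theta\, u+u^2)\frac{d\theta}{2\pi}\Big].$$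
   Context: Search time evolution matrix. Let $G=(X,E)$ be a connected simple graph with $|X|$ vertices and $\epsilon$ edges, $d_G(x)$ the degree of $x$ in $G$, and $M_X\subset X$ a set of marked vertices with $|M_X|=m$. Let $Y=\{x'\mid x\in X\}$ be a disjoint copy of $X$, $M_Y=\{x'\mid x\in M_X\}$. Let $E'=\{\{x,y'\},\{x',y\}\mid \{x,y\}\in E\}$, $E_2=\{\{x,x'\}\mid x\in M_X\}$, and $E_M=E'\cup E_2$, so $|E_M|=2\epsilon+m$. Define the $(2\epsilon+m)\times|X|$ matrix $K$ (rows indexed by $e\in E_M$, columns by $x\in X$) by $K_{e,x}=1/\sqrt{d_G(x)}$ if $x\in e$ and $x\notin M_X$; $K_{e,x}=1$ if $x\in e$ and $e\in E_2$; $K_{e,x}=0$ otherwise. Define $L$ (columns indexed by $x'\in Y$) analogously: $L_{e,x'}=1/\sqrt{d_G(x)}$ if $x'\in e$ and $x'\notin M_Y$; $L_{e,x'}=1$ if $x'\in e$ and $e\in E_2$; $0$ otherwise. The search time evolution matrix is $W'=(2LL^\top-I_{2\epsilon+m})(2KK^\top-I_{2\epsilon+m})$. Zeta function: for the $d$-dimensional torus $T^d_n$ (vertex set $(\mathbb Z/n\mathbb Z)^d$, which has $dn^d$ edges) and such a matrix $U$ of size $2dn^d+m$, $\zeta(U,T^d_n,u)=\det(I_{2dn^d+m}-uU)^{-1/n^d}$. Here $d=1$, $n=N$, $M_X=M$. *)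

theory Defs
  imports "HOL-Analysis.Henstock_Kurzweil_Integration" "Jordan_Normal_Form.Determinant"
begin

text \<open>A graph is given by a finite vertex set V and a set E of 2-element edges.
  The doubled vertex set X \<union> Y is modelled as 'a \<times> bool:
  (x, False) is x \<in> X and (x, True) is its copy x' \<in> Y.\<close>

definition gdeg :: "'a set set \<Rightarrow> 'a \<Rightarrow> nat" where
  "gdeg E x = card {e \<in> E. x \<in> e}"

definition E' :: "'a set set \<Rightarrow> ('a \<times> bool) set set" where
  "E' E = {{(x, False), (y, True)} | x y. {x, y} \<in> E}"

definition E2 :: "'a set \<Rightarrow> ('a \<times> bool) set set" where
  "E2 M = {{(x, False), (x, True)} | x. x \<in> M}"

definition EM :: "'a set set \<Rightarrow> 'a set \<Rightarrow> ('a \<times> bool) set set" where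
  "EM E M = E' E \<union> E2 M"

definition Kent :: "'a set set \<Rightarrow> 'a set \<Rightarrow> ('a \<times> bool) set \<Rightarrow> 'a \<Rightarrow> real" where
  "Kent E M e x =
     (if (x, False) \<in> e \<and> x \<notin> M then 1 / sqrt (real (gdeg E x))
      else if (x, False) \<in> e \<and> e \<in> E2 M then 1 else 0)"

definition Lent :: "'a set set \<Rightarrow> 'a set \<Rightarrow> ('a \<times> bool) set \<Rightarrow> 'a \<Rightarrow> real" where
  "Lent E M e x =
     (if (x, True) \<in> e \<and> x \<notin> M then 1 / sqrt (real (gdeg E x))
      else if (x, True) \<in> e \<and> e \<in> E2 M then 1 else 0)"

text \<open>Rows/columns are indexed via (arbitrary) enumerations of E_M and of X;
  the determinant used in the zeta function does not depend on the choice.\<close>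

definition edge_enum :: "'a set set \<Rightarrow> 'a set \<Rightarrow> ('a \<times> bool) set list" where
  "edge_enum E M = (SOME es. distinct es \<and> set es = EM E M)"

definition vert_enum :: "'a set \<Rightarrow> 'a list" where
  "vert_enum V = (SOME vs. distinct vs \<and> set vs = V)"

definition Kmat :: "'a set \<Rightarrow> 'a set set \<Rightarrow> 'a set \<Rightarrow> real mat" where
  "Kmat V E M = (let es = edge_enum E M; vs = vert_enum V in
     mat (length es) (length vs) (\<lambda>(i, j). Kent E M (es ! i) (vs ! j)))"

definition Lmat :: "'a set \<Rightarrow> 'a set set \<Rightarrow> 'a set \<Rightarrow> real mat" where
  "Lmat V E M = (let es = edge_enum E M; vs = vert_enum V in
     mat (length es) (length vs) (\<lambda>(i, j). Lent E M (es ! i) (vs ! j)))"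

definition search_W :: "'a set \<Rightarrow> 'a set set \<Rightarrow> 'a set \<Rightarrow> real mat" where
  "search_W V E M = (let K = Kmat V E M; L = Lmat V E M; n = dim_row K in
     (2 \<cdot>\<^sub>m (L * transpose_mat L) - 1\<^sub>m n) * (2 \<cdot>\<^sub>m (K * transpose_mat K) - 1\<^sub>m n))"

definition zeta_torus :: "real mat \<Rightarrow> nat \<Rightarrow> nat \<Rightarrow> real \<Rightarrow> real" where
  "zeta_torus U n d u = det (1\<^sub>m (dim_row U) - u \<cdot>\<^sub>m U) powr (- 1 / real (n ^ d))"

definition cycle_edges :: "nat \<Rightarrow> nat set set" where
  "cycle_edges N = {{j, (j + 1) mod N} | j. j < N}"

definition cycle_W :: "nat \<Rightarrow> nat set \<Rightarrow> real mat" where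
  "cycle_W N M = search_W {..<N} (cycle_edges N) M"

definition Fprime :: "nat \<Rightarrow> nat set \<Rightarrow> nat set" where
  "Fprime N M = {x \<in> {..<N} - M. (x + 1) mod N \<in> M \<and> (x + N - 1) mod N \<in> M}"

definition unmarked_adj :: "nat \<Rightarrow> nat set \<Rightarrow> nat \<Rightarrow> nat \<Rightarrow> bool" where
  "unmarked_adj N M a b \<longleftrightarrow> a \<in> {..<N} - M \<and> b \<in> {..<N} - M \<and>
     (b = (a + 1) mod N \<or> a = (b + 1) mod N)"

definition unmarked_comp :: "nat \<Rightarrow> nat set \<Rightarrow> nat \<Rightarrow> nat set" where
  "unmarked_comp N M x = {y. (unmarked_adj N M)\<^sup>*\<^sup>* x y}"

definition Fcomps :: "nat \<Rightarrow> nat set \<Rightarrow> nat set set" where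
  "Fcomps N M = {unmarked_comp N M x | x. x \<in> {..<N} - M \<and> x \<notin> Fprime N M}"

end

theory Submission
  imports "HOL-Complex_Analysis.Cauchy_Integral_Formula" Defs
begin

text \<open>On a cycle both reflections \<open>S\<^sub>L = 2LL\<^sup>T - I\<close> and \<open>S\<^sub>K = 2KK\<^sup>T - I\<close> are signed involutions of the
  edges: an unmarked vertex exchanges its two edges, a marked vertex fixes its two edges up to the
  sign \<open>-1\<close>, and its edge in \<open>E\<^sub>2\<close> is fixed. Since \<open>S\<^sub>L\<^sup>2 = I\<close>, we have
  \<open>det (I - u S\<^sub>L S\<^sub>K) = det S\<^sub>L \<cdot> det (S\<^sub>L - u S\<^sub>K)\<close>. Cutting the bipartite double cover of the cycle at
  the two lifts of a marked vertex gives two paths, and in the resulting order of the edges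
  \<open>S\<^sub>L - u S\<^sub>K\<close> is tridiagonal. Its continuant splits at every marked vertex, and a gap with \<open>n\<close> unmarked
  vertices contributes \<open>\<plusminus>(1 - u\<^bsup>n + 1\<^esup>)\<close> on each path, so that
  \<open>det (I - u W') = (1 - u)\<^bsup>m\<^esup> \<Prod> (1 - u\<^bsup>n + 1\<^esup>)\<^sup>2\<close> over all gaps. The cosine sums are logarithms of these
  factors, by factorising \<open>1 - u\<^bsup>n + 1\<^esup>\<close> over the roots of unity.

  The cosine sum of a component is bounded uniformly in its size, so it contributes nothing in the
  limit; and the integral vanishes by the mean value property of \<open>Ln (1 - u z)\<close> on the unit disc.\<close>

subsection \<open>Roots of unity and the logarithmic integral\<close>

text \<open>Both sides are polynomials in \<open>z\<close> of degree at most \<open>n\<close>, and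
  they agree at \<open>n + 1\<close> points: at 0, and at each \<open>n\<close>-th root of unity
  \<open>x\<close>, where the factor belonging to \<open>inverse x\<close> vanishes.\<close>

lemma prod_one_minus_roots_unity:
  fixes z :: complex
  assumes "n > 0"
  shows "(\<Prod>k<n. 1 - cis (2 * pi * real k / real n) * z) = 1 - z ^ n"
proof -
  define p where "p = (\<Prod>k<n. [:1, - cis (2 * pi * real k / real n):])"
  define q where "q = (1 :: complex poly) - monom 1 n"
  let ?S = "insert 0 {z::complex. z ^ n = 1}"
  have fin: "finite {z::complex. z ^ n = 1}" and card: "card {z::complex. z ^ n = 1} = n"
    using assms by (auto simp: card_roots_unity_eq finite_roots_unity)
  have "card ?S = Suc n"
    using fin card assms by (subst card_insert_disjoint) (auto simp: power_0_left)
  moreover have "degree p \<le> n"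
  proof -
    have "degree p \<le> (\<Sum>k<n. degree [:1, - cis (2 * pi * real k / real n):])"
      unfolding p_def using degree_prod_sum_le[of "{..<n}", unfolded o_def] by blast
    also have "\<dots> \<le> (\<Sum>k<n. 1)" by (intro sum_mono) auto
    finally show ?thesis by simp
  qed
  moreover have "degree q \<le> n"
    unfolding q_def by (intro degree_diff_le) (auto simp: degree_monom_le)
  moreover have "poly p x = poly q x" if "x \<in> ?S" for x
  proof (cases "x = 0")
    case True
    then show ?thesis using assms by (simp add: p_def q_def poly_prod poly_monom power_0_left)
  next
    case False
    with that have x: "x ^ n = 1" by auto
    then have "inverse x ^ n = 1" by (simp add: power_inverse)
    then have "inverse x \<in> (\<lambda>k. cis (2 * pi * real k / real n)) ` {..<n}"
      using bij_betw_imp_surj_on[OF Complex.bij_betw_roots_unity[OF assms]] by simp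
    then obtain k where k: "k < n" "cis (2 * pi * real k / real n) = inverse x"
      by (auto simp del: inverse_eq_divide)
    have "poly p x = 0"
      unfolding p_def poly_prod using k False by (auto simp: prod_zero_iff intro!: bexI[of _ k])
    then show ?thesis using x by (simp add: q_def poly_monom)
  qed
  ultimately have "p = q" by (intro poly_eqI_degree[of ?S]) auto
  then have "poly p z = poly q z" by simp
  then show ?thesis by (simp add: p_def q_def poly_prod poly_monom mult.commute)
qed

lemma cmod_one_minus_cis_squared:
  "(cmod (1 - cis t * of_real u))\<^sup>2 = 1 - 2 * cos t * u + u\<^sup>2"
proof -
  have alg: "(1 - a * u)\<^sup>2 + (b * u)\<^sup>2 = 1 - 2 * a * u + (b\<^sup>2 + a\<^sup>2) * u\<^sup>2" for a b :: real
    by (simp add: power2_eq_square algebra_simps)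
  have "(cmod (1 - cis t * of_real u))\<^sup>2 = (1 - cos t * u)\<^sup>2 + (sin t * u)\<^sup>2"
    by (simp add: cmod_power2)
  also have "\<dots> = 1 - 2 * cos t * u + ((sin t)\<^sup>2 + (cos t)\<^sup>2) * u\<^sup>2"
    using alg[of "cos t" "sin t"] .
  finally show ?thesis by simp
qed

lemma one_minus_cis_mult_nonzero:
  assumes "\<bar>u\<bar> < 1"
  shows "1 - cis t * of_real u \<noteq> 0"
proof
  assume "1 - cis t * of_real u = 0"
  then have "cmod (cis t * of_real u) = 1" by (metis eq_iff_diff_eq_0 norm_one)
  then show False using assms by (simp add: norm_mult)
qed

text \<open>The arguments of \<open>ln\<close> are the squared moduli of \<open>1 - z * u\<close>,
  where \<open>z\<close> runs over the nontrivial roots of unity of exponent \<open>n + 1\<close>.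
  The product of these numbers is \<open>(1 - u ^ (n + 1)) / (1 - u)\<close>, a geometric
  sum.\<close>

lemma sum_ln_cos_eq:
  fixes u :: real
  assumes "0 < u" "u < 1"
  shows "(\<Sum>k=1..n. ln (1 - 2 * cos (2 * real k * pi / (real n + 1)) * u + u\<^sup>2))
       = 2 * ln (\<Sum>i\<le>n. u ^ i)"
proof -
  define w where "w k = 1 - cis (2 * pi * real k / real (Suc n)) * of_real u" for k
  have w0: "w k \<noteq> 0" for k
    using assms one_minus_cis_mult_nonzero unfolding w_def by auto
  have "(1 - of_real u) * (\<Prod>k=1..n. w k) = (\<Prod>k<Suc n. w k)"
    unfolding lessThan_Suc_atMost atMost_atLeast0
    by (subst prod.atLeast_Suc_atMost) (auto simp: w_def)
  also have "\<dots> = 1 - of_real u ^ Suc n"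
    unfolding w_def by (rule prod_one_minus_roots_unity) simp
  also have "\<dots> = of_real ((1 - u) * (\<Sum>i\<le>n. u ^ i))"
    using arg_cong[OF one_diff_power_eq[of u "Suc n"], of complex_of_real]
    by (simp only: lessThan_Suc_atMost of_real_diff of_real_1 of_real_power)
  finally have "(\<Prod>k=1..n. w k) = of_real (\<Sum>i\<le>n. u ^ i)"
    using assms by simp
  moreover have pos: "0 < (\<Sum>i\<le>n. u ^ i)"
    using assms by (intro sum_pos) auto
  ultimately have "(\<Prod>k=1..n. cmod (w k)) = (\<Sum>i\<le>n. u ^ i)"
    by (metis abs_of_pos norm_of_real prod_norm)
  then have "2 * ln (\<Sum>i\<le>n. u ^ i) = (\<Sum>k=1..n. 2 * ln (cmod (w k)))"
    using w0 ln_prod[of "{1..n}" "\<lambda>k. cmod (w k)"] by (simp add: sum_distrib_left)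
  also have "\<dots> = (\<Sum>k=1..n. ln ((cmod (w k))\<^sup>2))"
    using w0 by (intro sum.cong refl) (simp add: ln_realpow)
  also have "\<dots> = (\<Sum>k=1..n. ln (1 - 2 * cos (2 * real k * pi / (real n + 1)) * u + u\<^sup>2))"
    unfolding w_def cmod_one_minus_cis_squared by (simp add: mult_ac add.commute)
  finally show ?thesis by simp
qed

text \<open>The integrand is twice the real part of \<open>Ln (1 - u * z)\<close> on the unit
  circle, and Cauchy's formula at the centre gives the mean value \<open>Ln 1 = 0\<close>.\<close>

lemma integral_ln_cos_eq_0:
  fixes u :: real
  assumes "0 < u" "u < 1"
  shows "integral {0..2 * pi} (\<lambda>\<theta>. ln (1 - 2 * cos \<theta> * u + u\<^sup>2)) = 0"
proof -
  let ?f = "\<lambda>z::complex. Ln (1 - of_real u * z)"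
  \<comment> \<open>A positive real part on the closed disc keeps the argument away from the branch
    cut of \<open>Ln\<close>.\<close>
  have Re_pos: "0 < Re (1 - of_real u * z)" if "cmod z \<le> 1" for z
  proof -
    have "u * Re z \<le> u * 1"
      using that assms abs_Re_le_cmod[of z] by (intro mult_left_mono) auto
    with assms(2) have "u * Re z < 1" by linarith
    then show ?thesis by (simp del: mult_le_cancel_left_pos)
  qed
  then have nonpos: "1 - of_real u * z \<notin> \<real>\<^sub>\<le>\<^sub>0" if "cmod z \<le> 1" for z
    using that by (metis complex_nonpos_Reals_iff not_less)
  have cont: "continuous_on (cball 0 1) ?f"
    by (intro continuous_intros) (use nonpos in auto)
  have "?f holomorphic_on ball 0 1"
    by (intro holomorphic_intros) (use nonpos in auto)
  then have "((\<lambda>w. ?f w / (w - 0)) has_contour_integral (2 * of_real pi * \<i> * ?f 0)) (circlepath 0 1)"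
    by (intro Cauchy_integral_circlepath cont) auto
  then have "((\<lambda>x. ?f (circlepath 0 1 x) / circlepath 0 1 x * vector_derivative (circlepath 0 1) (at x))
      has_integral 0) {0..1}"
    by (simp add: has_contour_integral)
  then have "((\<lambda>x. 2 * of_real pi * \<i> * ?f (cis (2 * pi * x))) has_integral 0) {0..1}"
    by (simp add: vector_derivative_circlepath) (simp add: circlepath cis_conv_exp mult_ac)
  then have "((\<lambda>x. ?f (cis (2 * pi * x))) has_integral 0) {0..1}"
    by (subst (asm) has_integral_mult_right_iff) auto
  from has_integral_Re[OF this]
  have "((\<lambda>x. Re (?f (cis (2 * pi * x)))) has_integral 0) {0..1}" by simp
  moreover have "Re (?f (cis t)) = ln (1 - 2 * cos t * u + u\<^sup>2) / 2" for t
  proof -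
    have nz: "1 - of_real u * cis t \<noteq> 0"
      using one_minus_cis_mult_nonzero[of u t] assms by (simp add: mult.commute)
    then have "ln ((cmod (1 - of_real u * cis t))\<^sup>2) = 2 * Re (?f (cis t))"
      by (simp add: ln_realpow)
    then show ?thesis
      using cmod_one_minus_cis_squared[of t u] by (simp add: mult.commute)
  qed
  ultimately have "((\<lambda>x. ln (1 - 2 * cos (2 * pi * x) * u + u\<^sup>2) / 2) has_integral 0) {0..1}"
    by simp
  from has_integral_stretch_real[OF this, of "1 / (2 * pi)"]
  have "((\<lambda>x. ln (1 - 2 * cos x * u + u\<^sup>2) / 2) has_integral 0) ((\<lambda>x. x * (2 * pi)) ` {0..1})"
    by simp
  also have "(\<lambda>x. x * (2 * pi)) ` {0..1} = {0..2 * pi}"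
    by (subst image_mult_atLeastAtMost_if') auto
  finally have "((\<lambda>x. ln (1 - 2 * cos x * u + u\<^sup>2) / 2) has_integral 0) {0..2 * pi}" .
  from has_integral_mult_right[OF this, of 2] show ?thesis
    by (intro integral_unique) simp
qed

subsection \<open>Determinants indexed by lists\<close>

text \<open>Labelling rows and columns by list elements lets determinants be reordered, split and
  compared through edges instead of indices.\<close>

definition ldet :: "('a \<Rightarrow> 'a \<Rightarrow> real) \<Rightarrow> 'a list \<Rightarrow> real" where
  "ldet A xs = Determinant.det (Matrix.mat (length xs) (length xs) (\<lambda>(i, j). A (xs ! i) (xs ! j)))"

lemma ldet_map: "ldet A (map f xs) = ldet (\<lambda>x y. A (f x) (f y)) xs"
  unfolding ldet_def by (rule arg_cong[of _ _ Determinant.det]) auto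

lemma ldet_cong:
  assumes "\<And>x y. x \<in> set xs \<Longrightarrow> y \<in> set xs \<Longrightarrow> A x y = B x y"
  shows "ldet A xs = ldet B xs"
  unfolding ldet_def using assms by (intro arg_cong[of _ _ Determinant.det]) auto

lemma ldet_Nil [simp]: "ldet A [] = 1"
  unfolding ldet_def by simp

text \<open>Reordering the list applies the same permutation to rows and columns, so its sign enters
  twice and cancels.\<close>

lemma ldet_mset_eq:
  assumes "mset xs = mset ys"
  shows "ldet A xs = ldet A ys"
proof -
  obtain p where p: "p permutes {..<length ys}" "permute_list p ys = xs"
    using mset_eq_permutation[OF assms] .
  define n where "n = length ys"
  have n: "length xs = n" "length ys = n" using assms mset_eq_length n_def by auto
  have p': "p permutes {0..<n}" using p(1) by (simp add: n_def atLeast0LessThan)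
  have nth: "xs ! i = ys ! p i" if "i < n" for i
    using that p unfolding n_def by (metis permute_list_nth)
  have lt: "p i < n" if "i < n" for i
    using p' that by (metis atLeastLessThan_iff permutes_in_image zero_le)
  define B where "B = Matrix.mat n n (\<lambda>(i, j). A (ys ! i) (ys ! j))"
  define C where "C = Matrix.mat n n (\<lambda>(i, j). B $$ (p i, j))"
  define D where "D = Matrix.mat n n (\<lambda>(i, j). transpose_mat C $$ (p i, j))"
  have B: "B \<in> carrier_mat n n" and C: "C \<in> carrier_mat n n" and D: "D \<in> carrier_mat n n"
    by (auto simp: B_def C_def D_def)
  have "ldet A xs = Determinant.det (transpose_mat D)"
    unfolding ldet_def n
    by (rule arg_cong[of _ _ Determinant.det]) (auto simp: D_def C_def B_def nth lt)
  also have "\<dots> = Determinant.det D" by (rule det_transpose[OF D])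
  also have "\<dots> = signof p * Determinant.det (transpose_mat C)"
    unfolding D_def by (rule det_permute_rows) (use C p' in auto)
  also have "Determinant.det (transpose_mat C) = Determinant.det C" by (rule det_transpose[OF C])
  also have "\<dots> = signof p * Determinant.det B"
    unfolding C_def by (rule det_permute_rows[OF B p'])
  finally have "ldet A xs = (signof p * signof p) * Determinant.det B" by simp
  also have "signof p * signof p = (1 :: real)" by (simp add: sign_def)
  finally show ?thesis by (simp add: ldet_def B_def n)
qed

lemma ldet_append:
  assumes "\<And>x y. x \<in> set xs \<Longrightarrow> y \<in> set ys \<Longrightarrow> A x y = 0"
  shows "ldet A (xs @ ys) = ldet A xs * ldet A ys"
proof -
  let ?n = "length xs" and ?m = "length ys"
  let ?M = "\<lambda>us vs. Matrix.mat (length us) (length vs) (\<lambda>(i, j). A (us ! i) (vs ! j))"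
  have "ldet A (xs @ ys)
    = Determinant.det (four_block_mat (?M xs xs) (?M xs ys) (?M ys xs) (?M ys ys))"
    unfolding ldet_def
    by (rule arg_cong[of _ _ Determinant.det]) (auto simp: nth_append)
  also have "\<dots> = ldet A xs * ldet A ys"
    unfolding ldet_def
    by (rule det_four_block_mat_upper_right_zero[of _ ?n _ ?m]) (use assms in auto)
  finally show ?thesis .
qed

lemma ldet_diagonal:
  assumes "distinct xs"
    and "\<And>x y. x \<in> set xs \<Longrightarrow> y \<in> set xs \<Longrightarrow> A x y = (if x = y then c else 0)"
  shows "ldet A xs = c ^ length xs"
  using assms
proof (induction xs)
  case (Cons x xs)
  have "ldet A [x] = c"
    using Cons.prems(2)[of x x] unfolding ldet_def by (simp add: det_single)
  moreover have "ldet A ([x] @ xs) = ldet A [x] * ldet A xs"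
    using Cons.prems by (intro ldet_append) auto
  ultimately show ?case using Cons by simp
qed simp

text \<open>Laplace expansion along the row of \<open>z\<close> leaves the entries at
  \<open>y\<close> and \<open>z\<close>; in the minor for \<open>y\<close>, the column of
  \<open>z\<close> has the single entry \<open>A y z\<close>. This is the continuant
  recurrence.\<close>

lemma ldet_tridiagonal:
  assumes "\<And>x. x \<in> set xs \<Longrightarrow> A x z = 0" "\<And>x. x \<in> set xs \<Longrightarrow> A z x = 0"
  shows "ldet A (xs @ [y, z]) = A z z * ldet A (xs @ [y]) - A y z * A z y * ldet A xs"
proof -
  define n where "n = length xs"
  define ws where "ws = xs @ [y, z]"
  let ?a = "\<lambda>(i, j). A (ws ! i) (ws ! j)"
  define X where "X = Matrix.mat (Suc (Suc n)) (Suc (Suc n)) ?a"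
  have X: "X \<in> carrier_mat (Suc (Suc n)) (Suc (Suc n))" by (simp add: X_def)
  define Y where "Y = mat_delete X (Suc n) n"
  have Y: "Y \<in> carrier_mat (Suc n) (Suc n)" using X by (simp add: Y_def mat_delete_def)
  have ws: "ws ! n = y" "ws ! Suc n = z" "i < n \<Longrightarrow> ws ! i = xs ! i" "i < n \<Longrightarrow> ws ! i \<in> set xs" for i
    by (auto simp: ws_def n_def nth_append)
  have "ldet A ws = Determinant.det X" by (simp add: ldet_def X_def ws_def n_def)
  also have "\<dots> = (\<Sum>j<Suc (Suc n). X $$ (Suc n, j) * cofactor X (Suc n) j)"
    by (rule laplace_expansion_row[OF X]) simp
  also have "\<dots> = X $$ (Suc n, n) * cofactor X (Suc n) n
      + X $$ (Suc n, Suc n) * cofactor X (Suc n) (Suc n)"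
    by (simp add: X_def ws(1,2) assms(2)[OF ws(4)])
  also have "cofactor X (Suc n) (Suc n) = ldet A (xs @ [y])"
    unfolding cofactor_def ldet_def
    by (simp, rule arg_cong[of _ _ Determinant.det])
      (auto simp: X_def mat_delete_def ws_def n_def nth_append)
  also have "cofactor X (Suc n) n = - Determinant.det Y"
    by (simp add: cofactor_def Y_def)
  also have "Determinant.det Y = (\<Sum>i<Suc n. Y $$ (i, n) * cofactor Y i n)"
    by (rule laplace_expansion_column[OF Y]) simp
  also have "\<dots> = Y $$ (n, n) * cofactor Y n n"
    by (simp add: Y_def X_def mat_delete_def ws(1,2) assms(1)[OF ws(4)])
  also have "cofactor Y n n = ldet A xs"
    unfolding cofactor_def ldet_def
    by (simp, rule arg_cong[of _ _ Determinant.det])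
      (auto simp: Y_def X_def mat_delete_def ws n_def nth_append)
  also have "Y $$ (n, n) = A y z"
    by (simp add: Y_def X_def mat_delete_def ws)
  finally show ?thesis by (simp add: X_def ws) (simp add: ws_def)
qed

subsection \<open>A continuant with marked positions\<close>

text \<open>With \<open>(x, y)\<close> standing for the edge joining \<open>x\<close> to the copy \<open>y'\<close>, the functions
  \<open>refl_entry M\<close> and its swapped version are the entries of
  \<open>2LL\<^sup>T - I\<close> and \<open>2KK\<^sup>T - I\<close> on a 2-regular graph.\<close>

definition refl_entry :: "'a set \<Rightarrow> 'a \<times> 'a \<Rightarrow> 'a \<times> 'a \<Rightarrow> real" where
  "refl_entry M e f = (if snd e = snd f then
       if snd e \<notin> M then 1 else if fst e = snd e \<and> fst f = snd f then 2 else 0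
     else 0) - (if e = f then 1 else 0)"

text \<open>The entries of \<open>S_L - u S_K\<close>. At \<open>u = 0\<close> they are those of
  \<open>S_L\<close>, so one family supplies both factors of
  \<open>det S_L * det (S_L - u S_K)\<close>.\<close>

definition pencil :: "'a set \<Rightarrow> real \<Rightarrow> 'a \<times> 'a \<Rightarrow> 'a \<times> 'a \<Rightarrow> real" where
  "pencil M u e f = refl_entry M e f - u * refl_entry M (prod.swap e) (prod.swap f)"

text \<open>In chain \<open>a\<close>, position \<open>i\<close> lies in \<open>X\<close> if \<open>a + i\<close> is even, where the reflection
  \<open>2KK\<^sup>T - I\<close> acts, and in \<open>Y\<close> otherwise.\<close>

definition level_coeff :: "nat \<Rightarrow> real \<Rightarrow> nat \<Rightarrow> real" where
  "level_coeff a u i = (if even (a + i) then - u else 1)"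

text \<open>The ratio of the leading minors at \<open>l + j\<close> and \<open>l\<close> when position \<open>l\<close> is marked and
  \<open>l + 1, \<dots>, l + j\<close> are not.\<close>

definition gap_minor :: "nat \<Rightarrow> real \<Rightarrow> nat \<Rightarrow> nat \<Rightarrow> real" where
  "gap_minor a u l j = (if even j then (-1) ^ (j div 2) * level_coeff a u (Suc l) ^ j
     else - ((-1) ^ (j div 2)) * level_coeff a u l ^ j)"

lemma gap_minor_0 [simp]: "gap_minor a u l 0 = 1"
  by (simp add: gap_minor_def)

lemma gap_minor_1 [simp]: "gap_minor a u l (Suc 0) = - level_coeff a u l"
  by (simp add: gap_minor_def)

text \<open>This is the continuant recurrence inside a gap, where the diagonal is zero. Position
  \<open>l + j + 1\<close> has the parity of the position whose coefficient is raised to the power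
  \<open>j\<close>.\<close>

lemma gap_minor_Suc_Suc:
  "gap_minor a u l (Suc (Suc j)) = - ((level_coeff a u (Suc (l + j)))\<^sup>2) * gap_minor a u l j"
  by (auto simp: gap_minor_def level_coeff_def power2_eq_square)

text \<open>The left side is the factor gained when the next marked position closes the gap. Up to
  sign, its two terms are the powers with exponent \<open>j + 1\<close> of the coefficients 1 and
  \<open>- u\<close>. The sign depends on \<open>a\<close>, \<open>l\<close> and \<open>j\<close>
  only and is therefore chosen before \<open>u\<close>.\<close>

lemma gap_minor_closed:
  "\<exists>s::real. s * s = 1 \<and>
     (\<forall>u. gap_minor a u l (Suc j) - level_coeff a u (l + Suc j) * gap_minor a u l j
          = s * (1 - u ^ Suc j))"
proof (cases "even j")
  case True
  then obtain i where j: "j = 2 * i" by blast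
  show ?thesis
    by (rule exI[of _ "- ((-1) ^ i)"])
      (auto simp: j gap_minor_def level_coeff_def algebra_simps simp flip: power_mult_distrib)
next
  case False
  then obtain i where j: "j = 2 * i + 1" by (elim oddE)
  show ?thesis
    by (rule exI[of _ "if even (a + l) then (-1) ^ Suc i else (-1) ^ i"])
      (auto simp: j gap_minor_def level_coeff_def algebra_simps simp flip: power_mult_distrib)
qed

definition prev_in :: "nat set \<Rightarrow> nat \<Rightarrow> nat" where
  "prev_in P k = Max {j \<in> P. j < k}"

lemma prev_in:
  assumes "0 \<in> P" "0 < k"
  shows "prev_in P k \<in> P" "prev_in P k < k" "\<And>j. prev_in P k < j \<Longrightarrow> j < k \<Longrightarrow> j \<notin> P"
proof -
  have fin: "finite {j \<in> P. j < k}" by simp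
  have "prev_in P k \<in> {j \<in> P. j < k}"
    unfolding prev_in_def using assms by (intro Max_in fin) auto
  then show "prev_in P k \<in> P" "prev_in P k < k" by auto
  show "j \<notin> P" if "prev_in P k < j" "j < k" for j
  proof
    assume "j \<in> P"
    with that have "j \<le> prev_in P k" unfolding prev_in_def by (intro Max_ge fin) auto
    with that show False by simp
  qed
qed

text \<open>\<open>D u k\<close> models the leading minors of a tridiagonal matrix. If
  \<open>Suc k\<close> is marked, the term with \<open>D u k\<close> drops out of the recurrence, so
  the minors factor there. The induction goes back from a marked position to the previous one,
  collecting one factor per gap and a sign independent of \<open>u\<close>.\<close>

lemma continuant_prod:
  fixes D :: "real \<Rightarrow> nat \<Rightarrow> real" and P :: "nat set" and a :: nat
  defines "d \<equiv> \<lambda>u i. if i \<in> P then level_coeff a u i else 0"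
  assumes P0: "0 \<in> P" and D0: "\<And>u. D u 0 = 1"
    and D1: "\<And>u. D u (Suc 0) = - (d u 0 + d u (Suc 0))"
    and D2: "\<And>u k. Suc (Suc k) \<le> N \<Longrightarrow> D u (Suc (Suc k)) =
      - (d u (Suc k) + d u (Suc (Suc k))) * D u (Suc k)
      - (if Suc k \<in> P then 0 else (level_coeff a u (Suc k))\<^sup>2) * D u k"
    and "k \<in> P" "k \<le> N"
  shows "\<exists>s::real. s * s = 1 \<and> (\<forall>u. D u k = s * (\<Prod>i\<in>P \<inter> {1..k}. 1 - u ^ (i - prev_in P i)))"
proof -
  \<comment> \<open>At an unmarked \<open>l + Suc j\<close> the value of \<open>d\<close> is 0, so
    the same formula gives \<open>D u l * gap_minor a u l (Suc j)\<close>; the induction uses this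
    at the two preceding positions.\<close>
  have step: "D u (l + Suc j) =
      D u l * (gap_minor a u l (Suc j) - d u (l + Suc j) * gap_minor a u l j)"
    if "l \<in> P" "l + Suc j \<le> N" "\<And>i. l < i \<Longrightarrow> i < l + Suc j \<Longrightarrow> i \<notin> P" for u l j
    using that
  proof (induction j rule: less_induct)
    case (less j)
    show ?case
    proof (cases j)
      case 0
      show ?thesis
      proof (cases l)
        case 0
        then show ?thesis using \<open>j = 0\<close> D0 D1 P0 by (simp add: d_def)
      next
        case (Suc l')
        then show ?thesis
          using \<open>j = 0\<close> D2[of l'] less.prems by (simp add: d_def algebra_simps)
      qed
    next
      case (Suc j')
      have D1': "D u (Suc (l + j')) = D u l * gap_minor a u l (Suc j')"
        using less.IH[of j'] less.prems Suc by (simp add: d_def)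
      have D0': "D u (l + j') = D u l * gap_minor a u l j'"
      proof (cases j')
        case (Suc i)
        then show ?thesis
          using less.IH[of i] less.prems \<open>j = Suc j'\<close> by (simp add: d_def)
      qed simp
      have nP: "Suc (l + j') \<notin> P" using less.prems(3) Suc by simp
      have "D u (l + Suc j) = - d u (l + Suc j) * D u (Suc (l + j'))
          - (level_coeff a u (Suc (l + j')))\<^sup>2 * D u (l + j')"
        using D2[of "l + j'" u] less.prems(2) nP Suc by (simp add: d_def)
      then show ?thesis
        unfolding D0' D1' Suc gap_minor_Suc_Suc by (simp add: algebra_simps)
    qed
  qed
  show ?thesis using \<open>k \<in> P\<close> \<open>k \<le> N\<close>
  proof (induction k rule: less_induct)
    case (less k)
    show ?case
    proof (cases "k = 0")
      case True
      then show ?thesis using D0 by (intro exI[of _ 1]) simp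
    next
      case False
      define l where "l = prev_in P k"
      have l: "l \<in> P" "l < k" "\<And>j. l < j \<Longrightarrow> j < k \<Longrightarrow> j \<notin> P"
        using prev_in[OF P0] False unfolding l_def by auto
      then obtain j where k: "k = l + Suc j" by (metis less_iff_Suc_add add_Suc_right)
      then have kl: "k - prev_in P k = Suc j" by (simp add: l_def)
      obtain s where s: "s * s = 1" "\<And>u. D u l = s * (\<Prod>i\<in>P \<inter> {1..l}. 1 - u ^ (i - prev_in P i))"
        using less.IH[of l] l less.prems by auto
      obtain t :: real where t: "t * t = 1"
        "\<And>u. gap_minor a u l (Suc j) - level_coeff a u (l + Suc j) * gap_minor a u l j
          = t * (1 - u ^ Suc j)"
        using gap_minor_closed by metis
      have "i \<le> l" if "i \<in> P" "i \<le> k" "i \<noteq> k" for i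
        using l(3) that by (metis le_neq_implies_less not_le)
      then have Q: "P \<inter> {1..k} = insert k (P \<inter> {1..l})"
        using \<open>l < k\<close> less.prems by auto
      have "D u k = (s * t) * (\<Prod>i\<in>P \<inter> {1..k}. 1 - u ^ (i - prev_in P i))" for u
      proof -
        have "D u k = D u l * (t * (1 - u ^ Suc j))"
          using step[of l j u] l less.prems t(2)[of u] unfolding k by (simp add: d_def)
        moreover have "(\<Prod>i\<in>P \<inter> {1..k}. 1 - u ^ (i - prev_in P i))
            = (1 - u ^ Suc j) * (\<Prod>i\<in>P \<inter> {1..l}. 1 - u ^ (i - prev_in P i))"
          unfolding Q using \<open>l < k\<close> kl by (subst prod.insert) auto
        ultimately show ?thesis unfolding s(2) by (simp only: mult_ac)
      qed
      moreover have "(s * t) * (s * t) = 1"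
        using s(1) t(1) by (metis mult.assoc mult.left_commute mult_1)
      ultimately show ?thesis by blast
    qed
  qed
qed

subsection \<open>The cycle cut open at a marked vertex\<close>

text \<open>For distinct ends the \<open>E_2\<close> alternative in \<open>refl_entry\<close> cannot
  occur. In its reflection, an unmarked end contributes \<open>1 - 1 = 0\<close> on the diagonal and
  1 off it, a marked end \<open>-1\<close> on the diagonal and 0 off it.\<close>

lemma pencil_offdiag:
  assumes "fst e \<noteq> snd e" "fst f \<noteq> snd f"
  shows "pencil M u e f =
    (if e = f then u * of_bool (fst e \<in> M) - of_bool (snd e \<in> M)
     else of_bool (snd e = snd f \<and> snd e \<notin> M) - u * of_bool (fst e = fst f \<and> fst e \<notin> M))"
  using assms by (cases e; cases f) (auto simp: pencil_def refl_entry_def)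

locale marked_cycle =
  fixes N :: nat and M :: "nat set" and g :: nat
  assumes N3: "3 \<le> N" and M_subset: "M \<subseteq> {..<N}" and g_marked: "g \<in> M"
begin

text \<open>The cycle is cut open at the marked vertex \<open>g\<close>, which occupies positions \<open>0\<close> and \<open>N\<close>;
  its bipartite double cover then falls apart into the two paths \<open>chain 0\<close> and \<open>chain 1\<close>.\<close>

definition pos :: "nat \<Rightarrow> nat" where
  "pos i = (g + i) mod N"

definition chain :: "nat \<Rightarrow> nat \<Rightarrow> nat \<times> nat" where
  "chain a i = (if even (a + i) then (pos i, pos (Suc i)) else (pos (Suc i), pos i))"

definition marked_pos :: "nat set" where
  "marked_pos = {i. pos i \<in> M}"

lemma finite_M: "finite M"
  using M_subset finite_subset by blast

lemma pos_less: "pos i < N"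
  using N3 by (simp add: pos_def)

lemma pos_0: "pos 0 = g" and pos_N: "pos N = g"
  using g_marked M_subset by (auto simp: pos_def)

lemma marked_pos_0: "0 \<in> marked_pos" and marked_pos_N: "N \<in> marked_pos"
  using g_marked by (simp_all add: marked_pos_def pos_0 pos_N)

lemma pos_Suc_mod: "(pos i + 1) mod N = pos (Suc i)"
  by (simp add: pos_def mod_Suc_eq)

lemma pos_eq_iff:
  assumes "i \<le> N" "j \<le> N"
  shows "pos i = pos j \<longleftrightarrow> i = j \<or> i = 0 \<and> j = N \<or> i = N \<and> j = 0"
proof -
  have *: "pos i = pos j \<longleftrightarrow> i = j \<or> i = 0 \<and> j = N" if "i \<le> j" "j \<le> N" for i j
  proof -
    have "pos i = pos j \<longleftrightarrow> N dvd (j - i)"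
      unfolding pos_def using that mod_eq_dvd_iff_nat[of "g + i" "g + j" N] by auto
    also have "\<dots> \<longleftrightarrow> i = j \<or> i = 0 \<and> j = N"
    proof
      assume "N dvd (j - i)"
      then obtain k where k: "j - i = N * k" by blast
      have "\<not> 2 \<le> k" using mult_le_mono2[of 2 k N] k that N3 by linarith
      then have "k \<le> 1" by simp
      with k that show "i = j \<or> i = 0 \<and> j = N" by (cases k) auto
    qed (use that in auto)
    finally show ?thesis .
  qed
  show ?thesis
    using *[of i j] *[of j i] assms N3 by (cases "i \<le> j") auto
qed

lemma pos_surj:
  assumes "x < N"
  obtains i where "i < N" "pos i = x"
proof -
  have "inj_on pos {..<N}" by (auto simp: inj_on_def pos_eq_iff)
  then have "pos ` {..<N} = {..<N}"
    by (intro endo_inj_surj) (auto simp: pos_less)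
  then have "x \<in> pos ` {..<N}" using assms by simp
  then show ?thesis using that by auto
qed

lemma chain_neq: "i < N \<Longrightarrow> fst (chain a i) \<noteq> snd (chain a i)"
  using N3 by (auto simp: chain_def pos_eq_iff)

text \<open>Since \<open>3 \<le> N\<close>, the unordered pair of ends determines the position; the
  order of the ends then determines the parity of \<open>a\<close>.\<close>

lemma chain_inj:
  assumes "i < N" "j < N" "a < 2" "b < 2"
  shows "chain a i = chain b j \<longleftrightarrow> a = b \<and> i = j"
proof
  assume eq: "chain a i = chain b j"
  then have "i = j"
    using assms N3 by (auto simp: chain_def pos_eq_iff split: if_splits)
  moreover from this eq have "even (a + i) \<longleftrightarrow> even (b + i)"
    using assms N3 by (auto simp: chain_def pos_eq_iff split: if_splits)
  ultimately show "a = b \<and> i = j" using assms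
    by (auto simp: less_2_cases_iff)
qed auto

lemma pencil_chain_diag:
  assumes "i < N"
  shows "pencil M u (chain a i) (chain a i) =
    - ((if i \<in> marked_pos then level_coeff a u i else 0)
       + (if Suc i \<in> marked_pos then level_coeff a u (Suc i) else 0))"
  using chain_neq[OF assms, of a]
  by (auto simp: pencil_offdiag marked_pos_def chain_def level_coeff_def)

lemma pencil_chain_Suc:
  assumes "Suc i < N" "a < 2"
  shows "pencil M u (chain a i) (chain a (Suc i))
      = (if Suc i \<in> marked_pos then 0 else level_coeff a u (Suc i))" (is ?thesis1)
    and "pencil M u (chain a (Suc i)) (chain a i)
      = (if Suc i \<in> marked_pos then 0 else level_coeff a u (Suc i))" (is ?thesis2)
proof -
  have neq: "fst (chain a i) \<noteq> snd (chain a i)" "fst (chain a (Suc i)) \<noteq> snd (chain a (Suc i))"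
    "chain a i \<noteq> chain a (Suc i)"
    using assms by (auto simp: chain_neq chain_inj)
  \<comment> \<open>The outer ends of consecutive edges could coincide only at the cut, that is at
    \<open>g\<close>, which is marked.\<close>
  have "pos i \<in> M" if "pos i = pos (Suc (Suc i))"
    using that assms g_marked pos_0 by (auto simp: pos_eq_iff)
  then show ?thesis1 ?thesis2
    using neq(3) unfolding pencil_offdiag[OF neq(1,2)] pencil_offdiag[OF neq(2,1)]
    by (auto simp: chain_def level_coeff_def marked_pos_def)
qed

text \<open>Off the diagonal, only a shared unmarked vertex on the same side gives a nonzero entry.
  The same position in different chains lies on opposite sides, and distinct positions coincide only
  at the cut, where the vertex is marked.\<close>

lemma pencil_chain_eq_0:
  assumes "i < N" "j < N" "a < 2" "b < 2" "a = b \<Longrightarrow> Suc i < j \<or> Suc j < i"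
  shows "pencil M u (chain a i) (chain b j) = 0"
proof -
  have neq: "chain a i \<noteq> chain b j" using assms by (auto simp: chain_inj)
  have marked: "pos s \<in> M"
    if "pos s = pos t" "s \<in> {i, Suc i}" "t \<in> {j, Suc j}" "even (a + s) = even (b + t)" for s t
  proof -
    have "s \<noteq> t"
    proof
      assume "s = t"
      then have "even a = even b" using that(4) by auto
      then have "a = b" using assms(3,4) by (auto simp: less_2_cases_iff)
      with assms(5) \<open>s = t\<close> that(2,3) show False by auto
    qed
    then have "s = 0 \<or> s = N" using that assms(1,2) by (auto simp: pos_eq_iff)
    then show ?thesis using g_marked pos_0 pos_N by auto
  qed
  have ends: "\<exists>s\<in>{i, Suc i}. fst (chain a i) = pos s \<and> even (a + s)"
    "\<exists>s\<in>{i, Suc i}. snd (chain a i) = pos s \<and> odd (a + s)" for a i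
    by (auto simp: chain_def)
  have "snd (chain a i) \<in> M" if "snd (chain a i) = snd (chain b j)"
    using that marked ends(2)[of i a] ends(2)[of j b] by metis
  moreover have "fst (chain a i) \<in> M" if "fst (chain a i) = fst (chain b j)"
    using that marked ends(1)[of i a] ends(1)[of j b] by metis
  ultimately show ?thesis
    using neq pencil_offdiag[OF chain_neq[OF assms(1)] chain_neq[OF assms(2)], of M u a b] by auto
qed

lemma ldet_chain:
  assumes "a < 2"
  shows "\<exists>s::real. s * s = 1 \<and> (\<forall>u. ldet (pencil M u) (map (chain a) [0..<N])
    = s * (\<Prod>i\<in>marked_pos \<inter> {1..N}. 1 - u ^ (i - prev_in marked_pos i)))"
proof (rule continuant_prod[where N = N and k = N and a = a and P = marked_pos
      and D = "\<lambda>u k. ldet (pencil M u) (map (chain a) [0..<k])"])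
  fix u
  show "ldet (pencil M u) (map (chain a) [0..<0]) = 1" by simp
  have "ldet (pencil M u) [chain a 0] = pencil M u (chain a 0) (chain a 0)"
    by (simp add: ldet_def det_single)
  then show "ldet (pencil M u) (map (chain a) [0..<Suc 0]) =
    - ((if 0 \<in> marked_pos then level_coeff a u 0 else 0)
       + (if Suc 0 \<in> marked_pos then level_coeff a u (Suc 0) else 0))"
    using N3 by (simp add: pencil_chain_diag)
  fix k assume k: "Suc (Suc k) \<le> N"
  have "ldet (pencil M u) (map (chain a) [0..<k] @ [chain a k, chain a (Suc k)]) =
      pencil M u (chain a (Suc k)) (chain a (Suc k)) * ldet (pencil M u) (map (chain a) [0..<k] @ [chain a k])
    - pencil M u (chain a k) (chain a (Suc k)) * pencil M u (chain a (Suc k)) (chain a k)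
      * ldet (pencil M u) (map (chain a) [0..<k])"
    using k assms by (intro ldet_tridiagonal) (auto intro!: pencil_chain_eq_0)
  then show "ldet (pencil M u) (map (chain a) [0..<Suc (Suc k)]) =
    - ((if Suc k \<in> marked_pos then level_coeff a u (Suc k) else 0)
       + (if Suc (Suc k) \<in> marked_pos then level_coeff a u (Suc (Suc k)) else 0))
       * ldet (pencil M u) (map (chain a) [0..<Suc k])
    - (if Suc k \<in> marked_pos then 0 else (level_coeff a u (Suc k))\<^sup>2)
       * ldet (pencil M u) (map (chain a) [0..<k])"
    using k assms by (simp add: pencil_chain_diag pencil_chain_Suc power2_eq_square)
qed (use marked_pos_0 marked_pos_N in auto)

text \<open>The pairs \<open>(x, x)\<close> stand for the edges of \<open>E_2\<close>. In this order
  the pencil is block diagonal: two tridiagonal blocks, then \<open>1 - u\<close> times the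
  identity.\<close>

definition edge_list :: "(nat \<times> nat) list" where
  "edge_list = map (chain 0) [0..<N] @ map (chain 1) [0..<N] @ map (\<lambda>x. (x, x)) (sorted_list_of_set M)"

lemma distinct_edge_list: "distinct edge_list"
proof -
  have "chain a i \<noteq> (x, x)" if "i < N" for a i x
    using chain_neq[OF that, of a] by auto
  then have "(x, x) \<notin> chain a ` {0..<N}" for a x by (metis atLeastLessThan_iff imageE)
  then show ?thesis
    unfolding edge_list_def using finite_M
    by (auto simp: distinct_map inj_on_def chain_inj)
qed

lemma set_edge_list:
  "set edge_list = {(x, y). x < N \<and> y < N \<and> (y = (x + 1) mod N \<or> x = (y + 1) mod N)}
     \<union> (\<lambda>x. (x, x)) ` M" (is "_ = ?E \<union> _")
proof -
  have "set (map (chain 0) [0..<N]) \<union> set (map (chain 1) [0..<N]) = ?E" (is "?C = _")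
  proof
    show "?C \<subseteq> ?E"
      using pos_Suc_mod by (auto simp: chain_def pos_less)
    show "?E \<subseteq> ?C"
    proof
      fix e assume "e \<in> ?E"
      then obtain x y where e: "e = (x, y)" "x < N" "y < N" "y = (x + 1) mod N \<or> x = (y + 1) mod N"
        by auto
      \<comment> \<open>Each cycle edge has one orientation in each chain; the parity of its
        position decides which.\<close>
      have step: "(pos i, pos (Suc i)) \<in> ?C" "(pos (Suc i), pos i) \<in> ?C" if "i < N" for i
      proof -
        have "(pos i, pos (Suc i)) = chain (if even i then 0 else 1) i"
          "(pos (Suc i), pos i) = chain (if even i then 1 else 0) i"
          by (auto simp: chain_def)
        with that show "(pos i, pos (Suc i)) \<in> ?C" "(pos (Suc i), pos i) \<in> ?C"
          by (auto split: if_splits)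
      qed
      obtain i j where "i < N" "pos i = x" "j < N" "pos j = y" using pos_surj e(2,3) by metis
      then show "e \<in> ?C" using step[of i] step[of j] e pos_Suc_mod by metis
    qed
  qed
  moreover have "set edge_list = ?C \<union> (\<lambda>x. (x, x)) ` M"
    unfolding edge_list_def using finite_M by (simp add: Un_assoc)
  ultimately show ?thesis by simp
qed

text \<open>Both chains yield the same product up to sign, hence the square; each edge of
  \<open>E_2\<close> yields \<open>1 - u\<close>.\<close>

lemma ldet_edge_list:
  "ldet (pencil M 0) edge_list * ldet (pencil M u) edge_list
   = (1 - u) ^ card M * (\<Prod>i\<in>marked_pos \<inter> {1..N}. 1 - u ^ (i - prev_in marked_pos i))\<^sup>2"
proof -
  let ?P = "\<lambda>u::real. \<Prod>i\<in>marked_pos \<inter> {1..N}. 1 - u ^ (i - prev_in marked_pos i)"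
  obtain s where s: "s * s = 1" "\<And>u. ldet (pencil M u) (map (chain 0) [0..<N]) = s * ?P u"
    using ldet_chain[of 0] by auto
  obtain t where t: "t * t = 1" "\<And>u. ldet (pencil M u) (map (chain 1) [0..<N]) = t * ?P u"
    using ldet_chain[of 1] by auto
  let ?d = "map (\<lambda>x. (x, x)) (sorted_list_of_set M)"
  have "ldet (pencil M u) ?d = (1 - u) ^ length ?d" for u
    using finite_M by (intro ldet_diagonal)
      (auto simp: distinct_map inj_on_def pencil_def refl_entry_def)
  then have d: "ldet (pencil M u) ?d = (1 - u) ^ card M" for u
    by simp
  have cd: "pencil M u (chain a i) (x, x) = 0" if "i < N" "x \<in> M" for u a i x
    using chain_neq[OF that(1), of a] that(2)
    by (cases "chain a i") (auto simp: pencil_def refl_entry_def)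
  have 1: "ldet (pencil M u) (map (chain 1) [0..<N] @ ?d)
      = ldet (pencil M u) (map (chain 1) [0..<N]) * ldet (pencil M u) ?d" for u
    using finite_M cd by (intro ldet_append) auto
  have 2: "ldet (pencil M u) edge_list = ldet (pencil M u) (map (chain 0) [0..<N])
      * ldet (pencil M u) (map (chain 1) [0..<N] @ ?d)" for u
    unfolding edge_list_def using finite_M cd
    by (intro ldet_append) (auto intro!: pencil_chain_eq_0)
  have *: "ldet (pencil M u) edge_list = (s * t) * (1 - u) ^ card M * (?P u)\<^sup>2" for u
    unfolding 2 1 s t d by (simp only: power2_eq_square mult_ac)
  \<comment> \<open>The signs \<open>s\<close> and \<open>t\<close> do not depend on \<open>u\<close>, so evaluating at \<open>u = 0\<close> removes them.\<close>
  have "1 - 0 ^ (i - prev_in marked_pos i) = (1::real)" if "i \<in> marked_pos \<inter> {1..N}" for i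
    using prev_in(2)[OF marked_pos_0, of i] that by (simp add: power_0_left)
  then have P0: "?P 0 = 1" by (rule prod.neutral[OF ballI])
  have 0: "ldet (pencil M 0) edge_list = s * t" unfolding *[of 0] P0 by simp
  have eq: "(s * t) * ((s * t) * x * y) = (s * s) * (t * t) * (x * y)" for x y :: real
    by (simp only: mult_ac)
  show ?thesis unfolding 0 *[of u] eq s(1) t(1) mult_1_left ..
qed

end

subsection \<open>Determinant of the search matrix\<close>

text \<open>Orthonormal columns make \<open>G\<close> in the proof a projection, so
  \<open>2 * G - I\<close> squares to \<open>4 * G * G - 4 * G + I = I\<close>.\<close>

lemma sum_reflection_squared:
  fixes l :: "'e \<Rightarrow> 'v \<Rightarrow> real"
  assumes fin: "finite S" "finite V"
    and orth: "\<And>z z'. z \<in> V \<Longrightarrow> z' \<in> V \<Longrightarrow> (\<Sum>f\<in>S. l f z * l f z') = of_bool (z = z')"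
    and "e \<in> S" "h \<in> S"
  defines "r \<equiv> \<lambda>e f. 2 * (\<Sum>z\<in>V. l e z * l f z) - of_bool (e = f)"
  shows "(\<Sum>f\<in>S. r e f * r f h) = of_bool (e = h)"
proof -
  define G where "G e f = (\<Sum>z\<in>V. l e z * l f z)" for e f
  have "(\<Sum>f\<in>S. G e f * G f h)
      = (\<Sum>f\<in>S. \<Sum>z\<in>V. \<Sum>z'\<in>V. (l e z * l h z') * (l f z * l f z'))"
    unfolding G_def sum_product by (simp add: mult_ac)
  also have "\<dots> = (\<Sum>z\<in>V. \<Sum>z'\<in>V. \<Sum>f\<in>S. (l e z * l h z') * (l f z * l f z'))"
    by (subst sum.swap, intro sum.cong refl, rule sum.swap)
  also have "\<dots> = (\<Sum>z\<in>V. \<Sum>z'\<in>V. if z = z' then l e z * l h z' else 0)"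
    by (intro sum.cong refl) (simp add: orth flip: sum_distrib_left)
  also have "\<dots> = G e h" using fin by (simp add: G_def)
  finally have GG: "(\<Sum>f\<in>S. G e f * G f h) = G e h" .
  have "(\<Sum>f\<in>S. r e f * r f h) = (\<Sum>f\<in>S. 4 * (G e f * G f h) - (if f = h then 2 * G e f else 0)
      - (if f = e then 2 * G f h else 0) + (if f = e then of_bool (e = h) else 0))"
    by (intro sum.cong refl) (auto simp: r_def G_def algebra_simps)
  also have "\<dots> = of_bool (e = h)"
    using fin assms(4,5) GG by (simp add: sum.distrib sum_subtractf flip: sum_distrib_left)
  finally show ?thesis .
qed

text \<open>As \<open>mR\<close> squares to the identity, \<open>1 - u * mR * mT\<close> equals
  \<open>mR * (mR - u * mT)\<close>.\<close>

lemma det_one_minus_product: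
  fixes R T :: "'e \<Rightarrow> 'e \<Rightarrow> real"
  assumes dist: "distinct es"
    and sq: "\<And>e h. e \<in> set es \<Longrightarrow> h \<in> set es \<Longrightarrow> (\<Sum>f\<in>set es. R e f * R f h) = of_bool (e = h)"
  defines "n \<equiv> length es"
  defines "mR \<equiv> Matrix.mat n n (\<lambda>(i, j). R (es ! i) (es ! j))"
  defines "mT \<equiv> Matrix.mat n n (\<lambda>(i, j). T (es ! i) (es ! j))"
  shows "Determinant.det (1\<^sub>m n - u \<cdot>\<^sub>m (mR * mT)) = ldet R es * ldet (\<lambda>e f. R e f - u * T e f) es"
proof -
  have carr: "mR \<in> carrier_mat n n" "mT \<in> carrier_mat n n" by (auto simp: mR_def mT_def)
  have "mR * mR = 1\<^sub>m n"
  proof (rule eq_matI)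
    fix i j assume ij: "i < dim_row (1\<^sub>m n :: real mat)" "j < dim_col (1\<^sub>m n :: real mat)"
    then have "(mR * mR) $$ (i, j) = (\<Sum>k<n. R (es ! i) (es ! k) * R (es ! k) (es ! j))"
      by (simp add: mR_def scalar_prod_def atLeast0LessThan)
    also have "\<dots> = (\<Sum>f\<in>set es. R (es ! i) f * R f (es ! j))"
      by (rule sum.reindex_bij_betw[OF bij_betw_nth]) (auto simp: n_def dist)
    also have "\<dots> = of_bool (i = j)"
      using ij dist by (subst sq) (auto simp: n_def nth_eq_iff_index_eq)
    finally show "(mR * mR) $$ (i, j) = 1\<^sub>m n $$ (i, j)" using ij by simp
  qed (simp_all add: mR_def)
  then have "1\<^sub>m n - u \<cdot>\<^sub>m (mR * mT) = mR * mR - mR * (u \<cdot>\<^sub>m mT)"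
    using carr by (simp add: mult_smult_distrib)
  also have "\<dots> = mR * (mR - u \<cdot>\<^sub>m mT)"
    using carr by (simp add: mult_minus_distrib_mat)
  also have "Determinant.det \<dots> = Determinant.det mR * Determinant.det (mR - u \<cdot>\<^sub>m mT)"
    using carr by (intro det_mult) auto
  also have "mR - u \<cdot>\<^sub>m mT = Matrix.mat n n (\<lambda>(i, j). R (es ! i) (es ! j) - u * T (es ! i) (es ! j))"
    by (rule eq_matI) (auto simp: mR_def mT_def)
  finally show ?thesis by (simp add: ldet_def mR_def n_def)
qed

lemma mat_reflection:
  fixes f :: "'e \<Rightarrow> 'v \<Rightarrow> real"
  assumes "distinct es" "distinct vs"
  defines "n \<equiv> length es"
  defines "A \<equiv> Matrix.mat n (length vs) (\<lambda>(i, j). f (es ! i) (vs ! j))"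
  shows "2 \<cdot>\<^sub>m (A * transpose_mat A) - 1\<^sub>m n
    = Matrix.mat n n (\<lambda>(i, j). 2 * (\<Sum>z\<in>set vs. f (es ! i) z * f (es ! j) z) - of_bool (es ! i = es ! j))"
    (is "?lhs = ?rhs")
proof (rule eq_matI)
  fix i j assume "i < dim_row ?rhs" "j < dim_col ?rhs"
  then have ij: "i < n" "j < n" by auto
  have "(A * transpose_mat A) $$ (i, j) = (\<Sum>k<length vs. f (es ! i) (vs ! k) * f (es ! j) (vs ! k))"
    using ij by (simp add: A_def scalar_prod_def atLeast0LessThan)
  also have "\<dots> = (\<Sum>z\<in>set vs. f (es ! i) z * f (es ! j) z)"
    by (rule sum.reindex_bij_betw[OF bij_betw_nth]) (auto simp: assms)
  finally show "?lhs $$ (i, j) = ?rhs $$ (i, j)"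
    using ij assms(1) by (auto simp: A_def n_def nth_eq_iff_index_eq)
qed (auto simp: A_def)

section \<open>Edges and incidence entries of the doubled cycle\<close>

definition double_edge :: "'a \<times> 'a \<Rightarrow> ('a \<times> bool) set" where
  "double_edge e = {(fst e, False), (snd e, True)}"

lemma double_edge_eq_iff [simp]: "double_edge e = double_edge f \<longleftrightarrow> e = f"
  by (cases e; cases f) (auto simp: double_edge_def doubleton_eq_iff)

lemma double_edge_in_E2: "double_edge e \<in> E2 M \<longleftrightarrow> fst e = snd e \<and> fst e \<in> M"
  by (auto simp: double_edge_def E2_def doubleton_eq_iff)

lemma cycle_neighbours:
  fixes N z :: nat
  assumes "3 \<le> N" "z < N"
  shows "{x. x < N \<and> (z = (x + 1) mod N \<or> x = (z + 1) mod N)} = {(z + 1) mod N, (z + N - 1) mod N}"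
    and "(z + 1) mod N \<noteq> (z + N - 1) mod N" "(z + 1) mod N \<noteq> z" "(z + N - 1) mod N \<noteq> z"
proof -
  have nxt: "(x + 1) mod N = (if x = N - 1 then 0 else x + 1)" if "x < N" for x
    using that by auto
  have "(z + N - 1) mod N = z - 1" if "z \<noteq> 0"
  proof -
    have eq: "z + N - 1 = z - 1 + N" using that by simp
    show ?thesis unfolding eq mod_add_self2 using assms by simp
  qed
  then have prev: "(z + N - 1) mod N = (if z = 0 then N - 1 else z - 1)"
    using assms by simp
  show "{x. x < N \<and> (z = (x + 1) mod N \<or> x = (z + 1) mod N)} = {(z + 1) mod N, (z + N - 1) mod N}"
  proof -
    have "z = (x + 1) mod N \<longleftrightarrow> x = (z + N - 1) mod N" if "x < N" for x
      unfolding prev nxt[OF that] using assms that by auto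
    moreover have "(z + 1) mod N < N" "(z + N - 1) mod N < N" using assms by auto
    ultimately show ?thesis by blast
  qed
  show "(z + 1) mod N \<noteq> (z + N - 1) mod N" "(z + 1) mod N \<noteq> z" "(z + N - 1) mod N \<noteq> z"
    unfolding prev nxt[OF assms(2)] using assms by auto
qed

lemma doubleton_in_cycle_edges:
  "{x, y} \<in> cycle_edges N \<longleftrightarrow> x < N \<and> y < N \<and> (y = (x + 1) mod N \<or> x = (y + 1) mod N)"
  by (auto simp: cycle_edges_def doubleton_eq_iff)

lemma gdeg_cycle:
  assumes "3 \<le> N" "z < N"
  shows "gdeg (cycle_edges N) z = 2"
proof -
  have "{e \<in> cycle_edges N. z \<in> e}
    = (\<lambda>x. {x, z}) ` {x. x < N \<and> (z = (x + 1) mod N \<or> x = (z + 1) mod N)}"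
    using assms by (auto simp: cycle_edges_def insert_commute)
  also have "\<dots> = {{(z + 1) mod N, z}, {(z + N - 1) mod N, z}}"
    unfolding cycle_neighbours(1)[OF assms] by simp
  also have "card \<dots> = 2"
    using cycle_neighbours(2-)[OF assms] by (simp add: card_insert_if doubleton_eq_iff)
  finally show ?thesis by (simp add: gdeg_def)
qed

context marked_cycle
begin

lemma EM_cycle: "EM (cycle_edges N) M = double_edge ` set edge_list"
proof -
  have gen: "{{(x, False), (y, True)} | x y. P x y} = double_edge ` {(x, y). P x y}"
    (is "?A = ?B") for P :: "nat \<Rightarrow> nat \<Rightarrow> bool"
  proof (intro equalityI subsetI)
    fix s assume "s \<in> ?A"
    then obtain x y where "P x y" "s = double_edge (x, y)" by (auto simp: double_edge_def)
    then show "s \<in> ?B" by blast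
  next
    fix s assume "s \<in> ?B"
    then obtain x y where "P x y" "s = {(x, False), (y, True)}" by (auto simp: double_edge_def)
    then show "s \<in> ?A" by blast
  qed
  have "E' (cycle_edges N)
    = double_edge ` {(x, y). x < N \<and> y < N \<and> (y = (x + 1) mod N \<or> x = (y + 1) mod N)}"
    unfolding E'_def doubleton_in_cycle_edges by (rule gen)
  moreover have "E2 M = double_edge ` (\<lambda>x. (x, x)) ` M"
    by (auto simp: E2_def double_edge_def image_iff)
  ultimately show ?thesis by (simp add: EM_def set_edge_list image_Un)
qed

lemma edge_list_bounds: "e \<in> set edge_list \<Longrightarrow> fst e < N \<and> snd e < N"
  using M_subset by (auto simp: set_edge_list)

lemma Lent_cycle:
  assumes "e \<in> set edge_list"
  shows "Lent (cycle_edges N) M (double_edge e) z =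
    (if z = snd e then if z \<notin> M then 1 / sqrt 2 else of_bool (fst e = snd e) else 0)"
  using edge_list_bounds[OF assms] gdeg_cycle[OF N3]
  by (auto simp: Lent_def double_edge_in_E2) (auto simp: double_edge_def)

lemma Kent_cycle:
  assumes "e \<in> set edge_list"
  shows "Kent (cycle_edges N) M (double_edge e) z =
    (if z = fst e then if z \<notin> M then 1 / sqrt 2 else of_bool (fst e = snd e) else 0)"
  using edge_list_bounds[OF assms] gdeg_cycle[OF N3]
  by (auto simp: Kent_def double_edge_in_E2) (auto simp: double_edge_def)

lemma Lent_reflection:
  assumes "e \<in> set edge_list" "f \<in> set edge_list"
  shows "2 * (\<Sum>z<N. Lent (cycle_edges N) M (double_edge e) z * Lent (cycle_edges N) M (double_edge f) z)
    - of_bool (double_edge e = double_edge f) = refl_entry M e f"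
proof -
  have "(\<Sum>z<N. Lent (cycle_edges N) M (double_edge e) z * Lent (cycle_edges N) M (double_edge f) z)
    = (\<Sum>z<N. if z = snd e then if snd e = snd f then
         if snd e \<notin> M then 1 / 2 else of_bool (fst e = snd e \<and> fst f = snd f) else 0 else 0)"
    unfolding Lent_cycle[OF assms(1)] Lent_cycle[OF assms(2)] by (intro sum.cong) auto
  then show ?thesis
    using edge_list_bounds[OF assms(1)] by (simp add: refl_entry_def)
qed

lemma Kent_reflection:
  assumes "e \<in> set edge_list" "f \<in> set edge_list"
  shows "2 * (\<Sum>z<N. Kent (cycle_edges N) M (double_edge e) z * Kent (cycle_edges N) M (double_edge f) z)
    - of_bool (double_edge e = double_edge f) = refl_entry M (prod.swap e) (prod.swap f)"
proof -
  have "(\<Sum>z<N. Kent (cycle_edges N) M (double_edge e) z * Kent (cycle_edges N) M (double_edge f) z)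
    = (\<Sum>z<N. if z = fst e then if fst e = fst f then
         if fst e \<notin> M then 1 / 2 else of_bool (fst e = snd e \<and> fst f = snd f) else 0 else 0)"
    unfolding Kent_cycle[OF assms(1)] Kent_cycle[OF assms(2)] by (intro sum.cong) auto
  then show ?thesis
    using edge_list_bounds[OF assms(1)] by (auto simp: refl_entry_def prod_eq_iff)
qed

text \<open>An edge has one end in \<open>Y\<close>, so different columns have disjoint supports. An
  unmarked column has two entries \<open>1 / sqrt 2\<close>, one for each neighbour; a marked column
  has a single 1, at its edge in \<open>E_2\<close>.\<close>

lemma Lent_orthonormal:
  assumes "z < N" "z' < N"
  shows "(\<Sum>e\<in>EM (cycle_edges N) M. Lent (cycle_edges N) M e z * Lent (cycle_edges N) M e z')
    = of_bool (z = z')"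
proof -
  let ?w = "\<lambda>e. if snd e = z \<and> z = z' then if z \<notin> M then 1 / 2 else of_bool (fst e = snd e) else (0::real)"
  have "(\<Sum>e\<in>EM (cycle_edges N) M. Lent (cycle_edges N) M e z * Lent (cycle_edges N) M e z')
    = (\<Sum>e\<in>set edge_list. Lent (cycle_edges N) M (double_edge e) z * Lent (cycle_edges N) M (double_edge e) z')"
    unfolding EM_cycle by (subst sum.reindex) (auto simp: inj_on_def)
  also have "\<dots> = (\<Sum>e\<in>set edge_list. ?w e)"
    by (intro sum.cong refl) (auto simp: Lent_cycle)
  also have "\<dots> = of_bool (z = z')"
  proof (cases "z = z'")
    case True
    show ?thesis
    proof (cases "z \<in> M")
      case True
      have "(\<Sum>e\<in>set edge_list. ?w e) = (\<Sum>e\<in>{(z, z)}. 1)"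
        using True \<open>z = z'\<close> by (intro sum.mono_neutral_cong_right[OF finite_set]) (auto simp: set_edge_list)
      then show ?thesis using \<open>z = z'\<close> by simp
    next
      case False
      let ?S = "(\<lambda>x. (x, z)) ` {x. x < N \<and> (z = (x + 1) mod N \<or> x = (z + 1) mod N)}"
      have "(\<Sum>e\<in>set edge_list. ?w e) = (\<Sum>e\<in>?S. 1 / 2)"
        using False \<open>z = z'\<close> assms
        by (intro sum.mono_neutral_cong_right[OF finite_set]) (auto simp: set_edge_list image_iff)
      also have "?S = {((z + 1) mod N, z), ((z + N - 1) mod N, z)}"
        unfolding cycle_neighbours(1)[OF N3 assms(1)] by simp
      finally show ?thesis using cycle_neighbours(2)[OF N3 assms(1)] \<open>z = z'\<close> by simp
    qed
  qed simp
  finally show ?thesis .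
qed

text \<open>Orthonormality of the columns of \<open>L\<close> makes \<open>S_L\<close> an
  involution, which gives the factorisation. The chosen enumeration and \<open>edge_list\<close>
  list the same edges without repetition, so they give equal determinants.\<close>

lemma det_cycle_W:
  "Determinant.det (1\<^sub>m (dim_row (cycle_W N M)) - u \<cdot>\<^sub>m cycle_W N M)
    = ldet (pencil M 0) edge_list * ldet (pencil M u) edge_list"
proof -
  define es where "es = edge_enum (cycle_edges N) M"
  define vs where "vs = vert_enum {..<N}"
  have fin: "finite (EM (cycle_edges N) M)" by (simp add: EM_cycle)
  then have es: "distinct es" "set es = EM (cycle_edges N) M"
    unfolding es_def edge_enum_def
    by (metis (mono_tags, lifting) finite_distinct_list someI_ex)+
  have vs: "distinct vs" "set vs = {..<N}"
    unfolding vs_def vert_enum_def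
    by (metis (mono_tags, lifting) finite_distinct_list finite_lessThan someI_ex)+
  let ?r = "\<lambda>l e f. 2 * (\<Sum>z<N. l e z * l f z) - of_bool (e = f) :: real"
  let ?L = "Lent (cycle_edges N) M" and ?K = "Kent (cycle_edges N) M"
  let ?n = "length es"
  have W: "cycle_W N M = Matrix.mat ?n ?n (\<lambda>(i, j). ?r ?L (es ! i) (es ! j))
      * Matrix.mat ?n ?n (\<lambda>(i, j). ?r ?K (es ! i) (es ! j))"
    unfolding cycle_W_def search_W_def Kmat_def Lmat_def Let_def es_def[symmetric] vs_def[symmetric]
      dim_row_mat(1) mat_reflection[OF es(1) vs(1)] vs(2) ..
  have "Determinant.det (1\<^sub>m (dim_row (cycle_W N M)) - u \<cdot>\<^sub>m cycle_W N M)
      = ldet (?r ?L) es * ldet (\<lambda>e f. ?r ?L e f - u * ?r ?K e f) es"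
    unfolding W index_mult_mat(2) dim_row_mat(1)
    by (rule det_one_minus_product[OF es(1)], rule sum_reflection_squared)
      (auto simp: es(2) Lent_orthonormal fin)
  moreover have "mset es = mset (map double_edge edge_list)"
    using es distinct_edge_list
    by (subst set_eq_iff_mset_eq_distinct[symmetric]) (auto simp: distinct_map inj_on_def EM_cycle)
  moreover have "ldet (?r ?L) (map double_edge edge_list) = ldet (pencil M 0) edge_list"
    unfolding ldet_map by (rule ldet_cong) (simp only: Lent_reflection, simp add: pencil_def)
  moreover have "ldet (\<lambda>e f. ?r ?L e f - u * ?r ?K e f) (map double_edge edge_list)
      = ldet (pencil M u) edge_list"
    unfolding ldet_map
    by (rule ldet_cong) (simp only: Lent_reflection Kent_reflection, simp add: pencil_def)
  ultimately show ?thesis using ldet_mset_eq by metis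
qed

end

subsection \<open>Gaps between marked vertices\<close>

context marked_cycle
begin

lemma pos_pred_mod:
  assumes "0 < k"
  shows "(pos k + N - 1) mod N = pos (k - 1)"
proof -
  define y where "y = pos (k - 1)"
  have y: "y < N" unfolding y_def by (rule pos_less)
  have "pos k = (y + 1) mod N"
    using pos_Suc_mod[of "k - 1"] assms by (simp add: y_def)
  also have "\<dots> = (if Suc y = N then 0 else Suc y)" using y by auto
  finally have "pos k + N - 1 = (if Suc y = N then y else y + N)" by auto
  then show ?thesis using y unfolding y_def[symmetric] by simp
qed

lemma unmarked_pos:
  assumes "x < N" "x \<notin> M"
  obtains k where "0 < k" "k < N" "pos k = x"
proof -
  obtain k where k: "k < N" "pos k = x" using pos_surj[OF assms(1)] .
  moreover have "k \<noteq> 0" using k(2) assms(2) pos_0 g_marked by metis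
  ultimately show thesis using that by simp
qed

text \<open>A gap is indexed by its right end. The least marked position beyond \<open>k\<close>
  exists because \<open>N\<close> is marked, and by minimality the marked position before it lies
  below \<open>k\<close>.\<close>

lemma next_marked:
  assumes "k < N" "k \<notin> marked_pos"
  obtains i where "i \<in> marked_pos \<inter> {1..N}" "prev_in marked_pos i < k" "k < i"
proof -
  define i where "i = (LEAST i. k < i \<and> i \<in> marked_pos)"
  have i: "k < i" "i \<in> marked_pos"
    using LeastI[of "\<lambda>i. k < i \<and> i \<in> marked_pos" N] assms(1) marked_pos_N unfolding i_def by auto
  have le: "i \<le> j" if "k < j" "j \<in> marked_pos" for j
    unfolding i_def using that by (intro Least_le) simp
  have "prev_in marked_pos i \<in> marked_pos" "prev_in marked_pos i < i"
    using prev_in[OF marked_pos_0, of i] i by auto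
  then have "prev_in marked_pos i < k"
    using le[of "prev_in marked_pos i"] assms(2) by (metis linorder_neqE_nat not_less)
  moreover have "i \<in> marked_pos \<inter> {1..N}"
    using i le[OF assms(1) marked_pos_N] by auto
  ultimately show thesis using that i by blast
qed

lemma gap_unmarked:
  assumes "i \<in> marked_pos \<inter> {1..N}" "prev_in marked_pos i < j" "j < i"
  shows "0 < j" "j < N" "pos j \<notin> M"
  using assms prev_in(3)[OF marked_pos_0, of i j] by (auto simp: marked_pos_def)

text \<open>Each adjacency moves the position by one, and the marked ends of the gap block the walk;
  conversely, unit steps inside the gap reach all of its positions.\<close>

lemma unmarked_comp_pos:
  assumes i: "i \<in> marked_pos \<inter> {1..N}" and k: "prev_in marked_pos i < k" "k < i"
  shows "unmarked_comp N M (pos k) = pos ` {prev_in marked_pos i<..<i}"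
proof
  let ?l = "prev_in marked_pos i" and ?adj = "unmarked_adj N M"
  have lP: "?l \<in> marked_pos" using prev_in(1)[OF marked_pos_0, of i] i by auto
  have step: "?adj (pos j) (pos (Suc j))" "?adj (pos (Suc j)) (pos j)" if "?l < j" "Suc j < i" for j
    using gap_unmarked[OF i, of j] gap_unmarked[OF i, of "Suc j"] that pos_Suc_mod[of j]
    by (auto simp: unmarked_adj_def pos_less)
  show "unmarked_comp N M (pos k) \<subseteq> pos ` {?l<..<i}"
  proof
    fix y assume "y \<in> unmarked_comp N M (pos k)"
    then have "?adj\<^sup>*\<^sup>* (pos k) y" by (simp add: unmarked_comp_def)
    then show "y \<in> pos ` {?l<..<i}"
    proof (induction rule: rtranclp_induct)
      case base
      then show ?case using k by simp
    next
      case (step y z)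
      then obtain j where j: "?l < j" "j < i" "y = pos j" by auto
      note gap = gap_unmarked[OF i j(1,2)]
      from step.hyps have z: "z < N" "z \<notin> M" and adj: "z = (y + 1) mod N \<or> y = (z + 1) mod N"
        by (auto simp: unmarked_adj_def)
      obtain j' where j': "0 < j'" "j' < N" "pos j' = z" using unmarked_pos[OF z] .
      from adj have "pos j' = pos (Suc j) \<or> pos j = pos (Suc j')"
        using pos_Suc_mod[of j] pos_Suc_mod[of j'] j j' by simp
      \<comment> \<open>Both \<open>j\<close> and \<open>j'\<close> lie strictly between 0 and
        \<open>N\<close>, which excludes the coincidence at the cut.\<close>
      then have "j' = Suc j \<or> j = Suc j'"
        using gap j' by (auto simp: pos_eq_iff)
      moreover have "j' \<noteq> i" "j' \<noteq> ?l"
        using z j' i lP by (auto simp: marked_pos_def)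
      ultimately have "j' \<in> {?l<..<i}" using j by auto
      then show ?case using j'(3) by blast
    qed
  qed
  show "pos ` {?l<..<i} \<subseteq> unmarked_comp N M (pos k)"
  proof
    fix y assume "y \<in> pos ` {?l<..<i}"
    then obtain j where j: "?l < j" "j < i" "y = pos j" by auto
    have "?adj\<^sup>*\<^sup>* (pos k) (pos j)"
    proof (cases "k \<le> j")
      case True
      then show ?thesis using j(2)
      proof (induction j rule: dec_induct)
        case (step n)
        then have "?adj\<^sup>*\<^sup>* (pos k) (pos n)" "?adj (pos n) (pos (Suc n))"
          using \<open>\<And>j. ?l < j \<Longrightarrow> Suc j < i \<Longrightarrow> ?adj (pos j) (pos (Suc j))\<close> k by auto
        then show ?case by (rule rtranclp.rtrancl_into_rtrancl)
      qed simp
    next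
      case False
      then have "j \<le> k" by simp
      then show ?thesis using j(1)
      proof (induction j rule: inc_induct)
        case (step n)
        then have "?adj\<^sup>*\<^sup>* (pos k) (pos (Suc n))" "?adj (pos (Suc n)) (pos n)"
          using \<open>\<And>j. ?l < j \<Longrightarrow> Suc j < i \<Longrightarrow> ?adj (pos (Suc j)) (pos j)\<close> k by auto
        then show ?case by (rule rtranclp.rtrancl_into_rtrancl)
      qed simp
    qed
    then show "y \<in> unmarked_comp N M (pos k)" using j by (simp add: unmarked_comp_def)
  qed
qed

lemma pos_in_Fprime_iff:
  assumes i: "i \<in> marked_pos \<inter> {1..N}" and k: "prev_in marked_pos i < k" "k < i"
  shows "pos k \<in> Fprime N M \<longleftrightarrow> i - prev_in marked_pos i = 2"
proof -
  note gap = gap_unmarked[OF i k]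
  have "pos k \<in> Fprime N M \<longleftrightarrow> Suc k \<in> marked_pos \<and> k - 1 \<in> marked_pos"
    using gap pos_less pos_Suc_mod[of k] pos_pred_mod[of k] by (simp add: Fprime_def marked_pos_def)
  also have "\<dots> \<longleftrightarrow> Suc k = i \<and> k - 1 = prev_in marked_pos i"
  proof
    assume *: "Suc k \<in> marked_pos \<and> k - 1 \<in> marked_pos"
    have "0 < i" "k - 1 < i" using k by auto
    then have "\<not> Suc k < i" "\<not> prev_in marked_pos i < k - 1"
      using prev_in(3)[OF marked_pos_0, of i "Suc k"] prev_in(3)[OF marked_pos_0, of i "k - 1"] k *
      by auto
    then show "Suc k = i \<and> k - 1 = prev_in marked_pos i" using k by auto
  next
    assume "Suc k = i \<and> k - 1 = prev_in marked_pos i"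
    then show "Suc k \<in> marked_pos \<and> k - 1 \<in> marked_pos"
      using i prev_in(1)[OF marked_pos_0, of i] by auto
  qed
  also have "\<dots> \<longleftrightarrow> i - prev_in marked_pos i = 2" using k by auto
  finally show ?thesis .
qed

text \<open>The range omits 0 because \<open>g\<close> occupies both 0 and \<open>N\<close> and is
  to be counted once.\<close>

lemma card_marked_pos: "card (marked_pos \<inter> {1..N}) = card M"
proof (rule bij_betw_same_card[of pos], unfold bij_betw_def, intro conjI)
  show "inj_on pos (marked_pos \<inter> {1..N})"
    by (auto simp: inj_on_def pos_eq_iff)
  show "pos ` (marked_pos \<inter> {1..N}) = M"
  proof (intro equalityI subsetI)
    fix x assume x: "x \<in> M"
    then obtain i where i: "i < N" "pos i = x" using M_subset pos_surj by blast
    show "x \<in> pos ` (marked_pos \<inter> {1..N})"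
    proof (cases "i = 0")
      case True
      then have "pos N = x" using i pos_0 pos_N by simp
      then show ?thesis using x N3 by (intro image_eqI[of _ _ N]) (auto simp: marked_pos_def)
    next
      case False
      then show ?thesis using x i by (intro image_eqI[of _ _ i]) (auto simp: marked_pos_def)
    qed
  qed (auto simp: marked_pos_def)
qed

lemma bij_betw_Fprime:
  "bij_betw (\<lambda>i. pos (i - 1)) {i \<in> marked_pos \<inter> {1..N}. i - prev_in marked_pos i = 2} (Fprime N M)"
  (is "bij_betw ?f ?Q _")
proof (unfold bij_betw_def, intro conjI equalityI subsetI)
  show "inj_on ?f ?Q" using N3 by (auto simp: inj_on_def pos_eq_iff)
  fix x assume "x \<in> ?f ` ?Q"
  then obtain i where i: "i \<in> ?Q" "x = pos (i - 1)" by auto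
  then show "x \<in> Fprime N M" by (subst i(2), subst pos_in_Fprime_iff[of i]) auto
next
  fix x assume x: "x \<in> Fprime N M"
  then obtain k where k: "0 < k" "k < N" "pos k = x"
    using unmarked_pos[of x] by (auto simp: Fprime_def)
  then have "k \<notin> marked_pos" using x by (auto simp: marked_pos_def Fprime_def)
  then obtain i where i: "i \<in> marked_pos \<inter> {1..N}" "prev_in marked_pos i < k" "k < i"
    using next_marked k by metis
  then have 2: "i - prev_in marked_pos i = 2" using pos_in_Fprime_iff x k by auto
  then have "k = i - 1" using i by auto
  then show "x \<in> ?f ` ?Q" using i 2 k by blast
qed

lemma bij_betw_Fcomps:
  "bij_betw (\<lambda>i. pos ` {prev_in marked_pos i<..<i})
     {i \<in> marked_pos \<inter> {1..N}. 2 < i - prev_in marked_pos i} (Fcomps N M)"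
  (is "bij_betw ?f ?Q _")
proof (unfold bij_betw_def, intro conjI equalityI subsetI)
  \<comment> \<open>The last vertex of the gap ending at \<open>i\<close> lies in the gap ending at
    \<open>j\<close>, so \<open>i - 1 < j\<close>; by symmetry the right ends agree.\<close>
  have *: "i \<le> j" if "i \<in> ?Q" "j \<in> ?Q" "?f i = ?f j" for i j
  proof -
    have "pos (i - 1) \<in> ?f j" using that by auto
    then obtain k where k: "prev_in marked_pos j < k" "k < j" "pos (i - 1) = pos k" by auto
    have "k < N" "0 < k" using gap_unmarked[OF _ k(1,2)] that(2) by auto
    then have "i - 1 = k" using k(3) that(1) by (auto simp: pos_eq_iff)
    then show ?thesis using k(2) by simp
  qed
  show "inj_on ?f ?Q"
  proof (rule inj_onI)
    fix i j assume "i \<in> ?Q" "j \<in> ?Q" "?f i = ?f j"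
    then show "i = j" using *[of i j] *[of j i] by simp
  qed
  fix C assume "C \<in> ?f ` ?Q"
  then obtain i where i: "i \<in> ?Q" "C = ?f i" by auto
  then have k: "prev_in marked_pos i < i - 1" "i - 1 < i" by auto
  have "C = unmarked_comp N M (pos (i - 1))" using unmarked_comp_pos[OF _ k] i by simp
  moreover have "pos (i - 1) \<notin> Fprime N M" using pos_in_Fprime_iff[OF _ k] i by auto
  moreover have "pos (i - 1) \<in> {..<N} - M" using gap_unmarked[OF _ k] i pos_less by auto
  ultimately show "C \<in> Fcomps N M" unfolding Fcomps_def by blast
next
  fix C assume "C \<in> Fcomps N M"
  then obtain x where x: "C = unmarked_comp N M x" "x < N" "x \<notin> M" "x \<notin> Fprime N M"
    by (auto simp: Fcomps_def)
  obtain k where k: "0 < k" "k < N" "pos k = x" using unmarked_pos[OF x(2,3)] .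
  then have "k \<notin> marked_pos" using x by (auto simp: marked_pos_def)
  then obtain i where i: "i \<in> marked_pos \<inter> {1..N}" "prev_in marked_pos i < k" "k < i"
    using next_marked k by metis
  then have "i - prev_in marked_pos i \<noteq> 2" using pos_in_Fprime_iff x k by auto
  then have "i \<in> ?Q" using i by auto
  moreover have "C = ?f i" using unmarked_comp_pos[OF i] x k by simp
  ultimately show "C \<in> ?f ` ?Q" by blast
qed

lemma card_gap:
  assumes "i \<in> marked_pos \<inter> {1..N}"
  shows "card (pos ` {prev_in marked_pos i<..<i}) = i - prev_in marked_pos i - 1"
proof -
  have "inj_on pos {prev_in marked_pos i<..<i}"
    using assms by (auto simp: inj_on_def pos_eq_iff)
  then show ?thesis by (simp add: card_image)
qed

text \<open>Each of the \<open>card M\<close> gaps gives \<open>1 - u\<close> times a geometric sum.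
  This sum is 1 for a gap of length 1, \<open>1 + u\<close> for length 2, which means a vertex of
  \<open>Fprime\<close>, and otherwise it runs up to the size of a component.\<close>

lemma prod_gaps:
  fixes u :: real
  shows "(\<Prod>i\<in>marked_pos \<inter> {1..N}. 1 - u ^ (i - prev_in marked_pos i))
    = (1 - u) ^ card M * (1 + u) ^ card (Fprime N M) * (\<Prod>C\<in>Fcomps N M. \<Sum>j\<le>card C. u ^ j)"
proof -
  let ?Q = "marked_pos \<inter> {1..N}"
  let ?gap = "\<lambda>i. i - prev_in marked_pos i"
  let ?R = "\<lambda>n. \<Sum>j\<le>n. u ^ j"
  have pos: "?gap i > 0" if "i \<in> ?Q" for i
    using prev_in(2)[OF marked_pos_0, of i] that by auto
  have "1 - u ^ ?gap i = (1 - u) * ?R (?gap i - 1)" if i: "i \<in> ?Q" for i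
  proof -
    obtain n where n: "?gap i = Suc n" using pos[OF i] gr0_conv_Suc by blast
    show ?thesis
      unfolding n using one_diff_power_eq[of u "Suc n"]
      by (simp add: lessThan_Suc_atMost del: power_Suc)
  qed
  then have "(\<Prod>i\<in>?Q. 1 - u ^ ?gap i) = (\<Prod>i\<in>?Q. (1 - u) * ?R (?gap i - 1))"
    by (intro prod.cong refl)
  also have "\<dots> = (1 - u) ^ card M * (\<Prod>i\<in>?Q. ?R (?gap i - 1))"
    by (simp only: prod.distrib prod_constant card_marked_pos)
  also have "(\<Prod>i\<in>?Q. ?R (?gap i - 1))
      = (\<Prod>i\<in>{i \<in> ?Q. ?gap i = 2} \<union> {i \<in> ?Q. 2 < ?gap i}. ?R (?gap i - 1))"
  proof (rule prod.mono_neutral_right)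
    show "\<forall>i\<in>?Q - ({i \<in> ?Q. ?gap i = 2} \<union> {i \<in> ?Q. 2 < ?gap i}). ?R (?gap i - 1) = 1"
    proof
      fix i assume "i \<in> ?Q - ({i \<in> ?Q. ?gap i = 2} \<union> {i \<in> ?Q. 2 < ?gap i})"
      then have "?gap i = 1" using pos[of i] by auto
      then show "?R (?gap i - 1) = 1" by simp
    qed
  qed auto
  also have "\<dots> = (\<Prod>i\<in>{i \<in> ?Q. ?gap i = 2}. ?R (?gap i - 1))
      * (\<Prod>i\<in>{i \<in> ?Q. 2 < ?gap i}. ?R (?gap i - 1))"
    by (rule prod.union_disjoint) auto
  also have "(\<Prod>i\<in>{i \<in> ?Q. ?gap i = 2}. ?R (?gap i - 1)) = (\<Prod>i\<in>{i \<in> ?Q. ?gap i = 2}. 1 + u)"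
    by (intro prod.cong refl) auto
  also have "\<dots> = (1 + u) ^ card (Fprime N M)"
    using bij_betw_same_card[OF bij_betw_Fprime] by simp
  also have "(\<Prod>i\<in>{i \<in> ?Q. 2 < ?gap i}. ?R (?gap i - 1))
      = (\<Prod>i\<in>{i \<in> ?Q. 2 < ?gap i}. ?R (card (pos ` {prev_in marked_pos i<..<i})))"
    by (intro prod.cong refl) (simp add: card_gap)
  also have "\<dots> = (\<Prod>C\<in>Fcomps N M. ?R (card C))"
    by (rule prod.reindex_bij_betw[OF bij_betw_Fcomps])
  finally show ?thesis by (simp add: mult.assoc)
qed

end

section \<open>Closed formula for the determinant and the zeta function\<close>

lemma det_cycle_W_eq:
  assumes "3 \<le> N" "M \<noteq> {}" "M \<subseteq> {..<N}"
  shows "Determinant.det (1\<^sub>m (dim_row (cycle_W N M)) - u \<cdot>\<^sub>m cycle_W N M)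
    = (1 - u) ^ (3 * card M) * (1 + u) ^ (2 * card (Fprime N M))
      * (\<Prod>C\<in>Fcomps N M. (\<Sum>j\<le>card C. u ^ j)\<^sup>2)"
proof -
  obtain g where "g \<in> M" using assms(2) by blast
  then interpret marked_cycle N M g using assms by unfold_locales
  \<comment> \<open>One factor \<open>(1 - u) ^ card M\<close> comes from \<open>E_2\<close>, two
    come from the squared product over the gaps.\<close>
  have cube: "(1 - u) ^ (3 * card M) = (1 - u) ^ card M * ((1 - u) ^ card M)\<^sup>2"
    by (simp flip: power_mult power_add)
  have "(1 - u) ^ card M * ((1 - u) ^ card M * x * y)\<^sup>2 = (1 - u) ^ (3 * card M) * x\<^sup>2 * y\<^sup>2" for x y
    unfolding cube power_mult_distrib by (simp only: mult_ac)
  then show ?thesis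
    unfolding det_cycle_W ldet_edge_list prod_gaps
    by (simp add: prod_power_distrib power_mult power_even_eq mult.commute[of 2])
qed

lemma inverse_zeta_cycle_W:
  assumes "0 < u" "u < 1" "3 \<le> N" "M \<noteq> {}" "M \<subseteq> {..<N}"
  shows "inverse (zeta_torus (cycle_W N M) N 1 u)
    = exp (3 * (real (card M) / real N) * ln (1 - u)
         + 2 * (real (card (Fprime N M)) / real N) * ln (1 + u)
         + 1 / real N * (\<Sum>C\<in>Fcomps N M. 2 * ln (\<Sum>j\<le>card C. u ^ j)))"
proof -
  let ?D = "Determinant.det (1\<^sub>m (dim_row (cycle_W N M)) - u \<cdot>\<^sub>m cycle_W N M)"
  have pos: "0 < (\<Sum>j\<le>n. u ^ j)" for n
    using assms by (intro sum_pos) auto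
  have posP: "0 < (\<Prod>C\<in>Fcomps N M. (\<Sum>j\<le>card C. u ^ j)\<^sup>2)"
    by (intro prod_pos ballI zero_less_power pos)
  \<comment> \<open>Positivity excludes the base 0, at which \<open>powr\<close> is 0 instead of an
    exponential.\<close>
  have "?D > 0"
    unfolding det_cycle_W_eq[OF assms(3-5)] using assms posP by simp
  have "ln ?D = ln ((1 - u) ^ (3 * card M)) + ln ((1 + u) ^ (2 * card (Fprime N M)))
      + ln (\<Prod>C\<in>Fcomps N M. (\<Sum>j\<le>card C. u ^ j)\<^sup>2)"
    unfolding det_cycle_W_eq[OF assms(3-5)] using assms posP by (simp add: ln_mult)
  also have "\<dots> = 3 * real (card M) * ln (1 - u) + 2 * real (card (Fprime N M)) * ln (1 + u)
      + ln (\<Prod>C\<in>Fcomps N M. (\<Sum>j\<le>card C. u ^ j)\<^sup>2)"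
    using assms by (simp add: ln_realpow)
  also have "ln (\<Prod>C\<in>Fcomps N M. (\<Sum>j\<le>card C. u ^ j)\<^sup>2)
      = (\<Sum>C\<in>Fcomps N M. 2 * ln (\<Sum>j\<le>card C. u ^ j))"
  \<comment> \<open>For an infinite index set the product defaults to 1 and the sum to 0.\<close>
  proof (cases "finite (Fcomps N M)")
    case True
    then have "ln (\<Prod>C\<in>Fcomps N M. (\<Sum>j\<le>card C. u ^ j)\<^sup>2)
        = (\<Sum>C\<in>Fcomps N M. ln ((\<Sum>j\<le>card C. u ^ j)\<^sup>2))"
      using pos by (intro ln_prod) (simp_all add: less_imp_neq[OF pos, symmetric])
    also have "\<dots> = (\<Sum>C\<in>Fcomps N M. 2 * ln (\<Sum>j\<le>card C. u ^ j))"
      by (intro sum.cong refl) (simp add: ln_realpow pos)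
    finally show ?thesis .
  qed simp
  finally have ln: "ln ?D = 3 * real (card M) * ln (1 - u) + 2 * real (card (Fprime N M)) * ln (1 + u)
      + (\<Sum>C\<in>Fcomps N M. 2 * ln (\<Sum>j\<le>card C. u ^ j))" .
  have "inverse (zeta_torus (cycle_W N M) N 1 u) = exp (1 / real N * ln ?D)"
    using \<open>?D > 0\<close> by (simp add: zeta_torus_def powr_def exp_minus)
  then show ?thesis unfolding ln by (simp add: distrib_left)
qed

theorem theorem1:
  fixes u :: real
  assumes "0 < u" and "u < 1"
  shows
   "(\<forall>(N::nat) (M::nat set). 3 \<le> N \<and> M \<noteq> {} \<and> M \<subseteq> {..<N} \<longrightarrow>
       inverse (zeta_torus (cycle_W N M) N 1 u) =
       exp (3 * (real (card M) / real N) * ln (1 - u)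
            + 2 * (real (card (Fprime N M)) / real N) * ln (1 + u)
            + 1 / real N * (\<Sum>C\<in>Fcomps N M. \<Sum>k=1..card C.
                 ln (1 - 2 * cos (2 * real k * pi / (real (card C) + 1)) * u + u\<^sup>2))))
    \<and>
    (\<forall>(Ns::nat \<Rightarrow> nat) (Ms::nat \<Rightarrow> nat set) (r::nat) (c::nat \<Rightarrow> real) (cM::real) (cF'::real).
       filterlim Ns at_top sequentially \<and>
       (\<forall>k. 3 \<le> Ns k \<and> Ms k \<noteq> {} \<and> Ms k \<subseteq> {..<Ns k} \<and>
            real (card (Ms k)) = cM * real (Ns k) \<and>
            real (card (Fprime (Ns k) (Ms k))) = cF' * real (Ns k) \<and>
            (\<exists>f. bij_betw f {..<r} (Fcomps (Ns k) (Ms k)) \<and>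
                 (\<forall>j<r. real (card (f j)) = c j * real (Ns k))))
       \<longrightarrow>
       (\<lambda>k. inverse (zeta_torus (cycle_W (Ns k) (Ms k)) (Ns k) 1 u)) \<longlonglongrightarrow>
       exp (3 * cM * ln (1 - u) + 2 * cF' * ln (1 + u)
            + (\<Sum>j<r. c j) * (integral {0..2 * pi} (\<lambda>\<theta>. ln (1 - 2 * cos \<theta> * u + u\<^sup>2)) / (2 * pi))))"
proof (intro conjI allI impI)
  fix N :: nat and M :: "nat set"
  assume "3 \<le> N \<and> M \<noteq> {} \<and> M \<subseteq> {..<N}"
  then show "inverse (zeta_torus (cycle_W N M) N 1 u) =
       exp (3 * (real (card M) / real N) * ln (1 - u)
            + 2 * (real (card (Fprime N M)) / real N) * ln (1 + u)
            + 1 / real N * (\<Sum>C\<in>Fcomps N M. \<Sum>k=1..card C.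
                 ln (1 - 2 * cos (2 * real k * pi / (real (card C) + 1)) * u + u\<^sup>2)))"
    unfolding sum_ln_cos_eq[OF assms] using assms inverse_zeta_cycle_W by blast
next
  fix Ns :: "nat \<Rightarrow> nat" and Ms :: "nat \<Rightarrow> nat set" and r :: nat and c :: "nat \<Rightarrow> real"
    and cM cF' :: real
  assume *: "filterlim Ns at_top sequentially \<and>
       (\<forall>k. 3 \<le> Ns k \<and> Ms k \<noteq> {} \<and> Ms k \<subseteq> {..<Ns k} \<and>
            real (card (Ms k)) = cM * real (Ns k) \<and>
            real (card (Fprime (Ns k) (Ms k))) = cF' * real (Ns k) \<and>
            (\<exists>f. bij_betw f {..<r} (Fcomps (Ns k) (Ms k)) \<and>
                 (\<forall>j<r. real (card (f j)) = c j * real (Ns k))))"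
  define S where "S k = (\<Sum>C\<in>Fcomps (Ns k) (Ms k). 2 * ln (\<Sum>j\<le>card C. u ^ j))" for k
  have eq: "inverse (zeta_torus (cycle_W (Ns k) (Ms k)) (Ns k) 1 u)
      = exp (3 * cM * ln (1 - u) + 2 * cF' * ln (1 + u) + 1 / real (Ns k) * S k)" for k
  proof -
    have k: "3 \<le> Ns k" "Ms k \<noteq> {}" "Ms k \<subseteq> {..<Ns k}" "real (card (Ms k)) = cM * real (Ns k)"
      "real (card (Fprime (Ns k) (Ms k))) = cF' * real (Ns k)"
      using * by auto
    then show ?thesis
      unfolding inverse_zeta_cycle_W[OF assms k(1-3)] S_def k(4,5) by simp
  qed
  \<comment> \<open>The number \<open>r\<close> of components is fixed and each geometric sum lies
    between 1 and \<open>1 / (1 - u)\<close>, so the bound does not depend on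
    \<open>k\<close>.\<close>
  have bound: "norm (S k) \<le> real r * (2 * ln (1 / (1 - u)))" for k
  proof -
    obtain f where "bij_betw f {..<r} (Fcomps (Ns k) (Ms k))" using * by blast
    then have card: "card (Fcomps (Ns k) (Ms k)) = r"
      using bij_betw_same_card by fastforce
    have "norm (2 * ln (\<Sum>j\<le>n. u ^ j)) \<le> 2 * ln (1 / (1 - u))" for n
    proof -
      have "(\<Sum>j\<le>n. u ^ j) = (1 - u ^ Suc n) / (1 - u)"
        using assms one_diff_power_eq[of u "Suc n"]
        by (simp add: lessThan_Suc_atMost field_simps del: power_Suc)
      also have "\<dots> \<le> 1 / (1 - u)" using assms by (intro divide_right_mono) auto
      finally have "(\<Sum>j\<le>n. u ^ j) \<le> 1 / (1 - u)" .
      moreover have "1 \<le> (\<Sum>j\<le>n. u ^ j)"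
        using assms sum_mono2[of "{..n}" "{0}" "\<lambda>j. u ^ j"] by auto
      ultimately show ?thesis using assms by auto
    qed
    then have "norm (S k) \<le> (\<Sum>C\<in>Fcomps (Ns k) (Ms k). 2 * ln (1 / (1 - u)))"
      unfolding S_def by (rule sum_norm_le)
    then show ?thesis using card by simp
  qed
  have "(\<lambda>k. 1 / real (Ns k)) \<longlonglongrightarrow> 0"
    using * by (intro tendsto_divide_0[OF tendsto_const] filterlim_at_top_imp_at_infinity
        filterlim_compose[OF filterlim_real_sequentially]) simp
  from tendsto_mult_left_zero[OF this] have "(\<lambda>k. 1 / real (Ns k) * S k) \<longlonglongrightarrow> 0"
    by (rule Lim_null_comparison[rotated, where g = "\<lambda>k. 1 / real (Ns k) * (real r * (2 * ln (1 / (1 - u))))"])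
      (use bound in \<open>auto simp: abs_mult divide_right_mono\<close>)
  then have "(\<lambda>k. exp (3 * cM * ln (1 - u) + 2 * cF' * ln (1 + u) + 1 / real (Ns k) * S k))
      \<longlonglongrightarrow> exp (3 * cM * ln (1 - u) + 2 * cF' * ln (1 + u) + 0)"
    by (intro tendsto_intros)
  then show "(\<lambda>k. inverse (zeta_torus (cycle_W (Ns k) (Ms k)) (Ns k) 1 u)) \<longlonglongrightarrow>
       exp (3 * cM * ln (1 - u) + 2 * cF' * ln (1 + u)
            + (\<Sum>j<r. c j) * (integral {0..2 * pi} (\<lambda>\<theta>. ln (1 - 2 * cos \<theta> * u + u\<^sup>2)) / (2 * pi)))"
    unfolding eq integral_ln_cos_eq_0[OF assms] by simp
qed


end
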